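(* Let $(M,d)$ be a complete pointed metric space with base point $0$ and let $m \in \mathcal{F}(M)$. Then there exists a positive Radon measure $\mu$ on $\beta\widetilde{M}$ with $\|\mu\| = \|\Phi^*\mu\|$ (i.e. $\mu$ is an optimal representation), $\Phi^*\mu = m$, and $\mu$ concentrated on $p^{-1}(M \times M)$, i.e. $\mu(\beta\widetilde{M}\setminus p^{-1}(M\times M))=0$.
   Context: $\mathrm{Lip}_0(M)$ is the Banach space of Lipschitz $f:M\to\mathbb{R}$ with $f(0)=0$, normed by the Lipschitz constant. $\delta:M\to \mathrm{Lip}_0(M)^*$ is evaluation, $\langle f,\delta(x)\rangle=f(x)$, and the Lipschitz-free space $\mathcal{F}(M)\subset\mathrm{Lip}_0(M)^*$ is the norm-closed linear span of $\delta(M)$. Let $\widetilde{M}=\{(x,y)\in M\times M: x\neq y\}$, let $\beta\widetilde{M}$ be its Stone–Čech compactification, and identify the space $\mathcal{M}(\beta\widetilde{M})$ of signed Radon measures with $C(\beta\widetilde{M})^*$. The De Leeuw transform $\Phi:\mathrm{Lip}_0(M)\to C(\beta\widetilde{M})$ sends $f$ to the continuous extension to $\beta\widetilde{M}$ of $(x,y)\mapsto (f(x)-f(y))/d(x,y)$; $\Phi^*:\mathcal{M}(\beta\widetilde{M})\to \mathrm{Lip}_0(M)^*$ is its adjoint. Let $M^{u}$ be the uniform (Samuel) compactification of $M$ (the compactification to which every bounded uniformly continuous function on $M$ extends continuously, and in which subsets $A,B\subset M$ have disjoint closures iff $d(A,B)>0$). $p_1,p_2:\beta\widetilde{M}\to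 M^{u}$ are the continuous extensions of $(x,y)\mapsto x$ and $(x,y)\mapsto y$, and $p=(p_1,p_2):\beta\widetilde{M}\to M^{u}\times M^{u}$. Throughout, $M$ is assumed to have at least three distinct points. *)

theory Defs
  imports "HOL-Analysis.Analysis"
begin

text \<open>The pointed metric space M is the type 'a with base point z.
  Functions on M are of type 'a => real; functionals on Lip_0(M) are of type
  ('a => real) => real (only their values on Lip_0(M) matter).\<close>

definition Lip0 :: "'a::metric_space \<Rightarrow> ('a \<Rightarrow> real) set" where
  "Lip0 z = {f. f z = 0 \<and> (\<exists>L. lipschitz_on L UNIV f)}"

definition lipnorm :: "('a::metric_space \<Rightarrow> real) \<Rightarrow> real" where
  "lipnorm f = (SUP p\<in>{(x,y). x \<noteq> y}. \<bar>f (fst p) - f (snd p)\<bar> / dist (fst p) (snd p))"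

definition lip0_dual :: "'a::metric_space \<Rightarrow> (('a \<Rightarrow> real) \<Rightarrow> real) \<Rightarrow> bool" where
  "lip0_dual z m \<longleftrightarrow>
     (\<forall>f\<in>Lip0 z. \<forall>g\<in>Lip0 z. \<forall>a b::real. m (\<lambda>x. a * f x + b * g x) = a * m f + b * m g) \<and>
     (\<exists>C. \<forall>f\<in>Lip0 z. \<bar>m f\<bar> \<le> C * lipnorm f)"

definition dnorm :: "'a::metric_space \<Rightarrow> (('a \<Rightarrow> real) \<Rightarrow> real) \<Rightarrow> real" where
  "dnorm z m = (SUP f\<in>{f\<in>Lip0 z. lipnorm f \<le> 1}. \<bar>m f\<bar>)"

definition free_space :: "'a::metric_space \<Rightarrow> (('a \<Rightarrow> real) \<Rightarrow> real) set" where
  "free_space z = {m. lip0_dual z m \<and>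
     (\<forall>\<epsilon>>0. \<exists>S a. finite S \<and> dnorm z (\<lambda>f. m f - (\<Sum>x\<in>S. a x * f x)) < \<epsilon>)}"

definition Mt :: "('a \<times> 'a) set" where
  "Mt = {(x,y). x \<noteq> y}"

definition Cb_Mt :: "('a::metric_space \<times> 'a \<Rightarrow> real) set" where
  "Cb_Mt = {g. continuous_on Mt g \<and> bounded (g ` Mt)}"

text \<open>Stone-Cech compactification of M-tilde, realised (Cech's construction) as the
  closure of the evaluation embedding of M-tilde into the product space
  R^{C_b(M-tilde)} (product topology = pointwise topology on the function type).
  A point zeta acts on g in C_b(M-tilde) by zeta g = continuous extension of g at zeta.\<close>
definition ev_Mt :: "'a::metric_space \<times> 'a \<Rightarrow> ('a \<times> 'a \<Rightarrow> real) \<Rightarrow> real" where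
  "ev_Mt p = (\<lambda>g. if g \<in> Cb_Mt then g p else 0)"

definition beta_Mt :: "((('a::metric_space \<times> 'a) \<Rightarrow> real) \<Rightarrow> real) set" where
  "beta_Mt = closure (ev_Mt ` Mt)"

text \<open>Bounded uniformly continuous functions on M; uniform (Samuel) compactification
  M^u as closure of the evaluation embedding into R^{BUC(M)}.\<close>
definition BUC :: "('a::metric_space \<Rightarrow> real) set" where
  "BUC = {h. uniformly_continuous_on UNIV h \<and> bounded (range h)}"

definition ev_M :: "'a::metric_space \<Rightarrow> ('a \<Rightarrow> real) \<Rightarrow> real" where
  "ev_M x = (\<lambda>h. if h \<in> BUC then h x else 0)"

definition unif_compact :: "(('a::metric_space \<Rightarrow> real) \<Rightarrow> real) set" where
  "unif_compact = closure (range ev_M)"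

text \<open>p1, p2: continuous extensions of (x,y) |-> x and (x,y) |-> y to beta_Mt
  (composition with the projections).\<close>
definition p1 :: "((('a::metric_space \<times> 'a) \<Rightarrow> real) \<Rightarrow> real) \<Rightarrow> ('a \<Rightarrow> real) \<Rightarrow> real" where
  "p1 \<zeta> = (\<lambda>h. if h \<in> BUC then \<zeta> (\<lambda>(x,y). h x) else 0)"

definition p2 :: "((('a::metric_space \<times> 'a) \<Rightarrow> real) \<Rightarrow> real) \<Rightarrow> ('a \<Rightarrow> real) \<Rightarrow> real" where
  "p2 \<zeta> = (\<lambda>h. if h \<in> BUC then \<zeta> (\<lambda>(x,y). h y) else 0)"

definition p_inv_MM :: "((('a::metric_space \<times> 'a) \<Rightarrow> real) \<Rightarrow> real) set" where
  "p_inv_MM = {\<zeta>\<in>beta_Mt. p1 \<zeta> \<in> range ev_M \<and> p2 \<zeta> \<in> range ev_M}"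

text \<open>De Leeuw transform of f (on M-tilde); its extension to beta_Mt is zeta |-> zeta (Phi f).\<close>
definition deleeuw :: "('a::metric_space \<Rightarrow> real) \<Rightarrow> ('a \<times> 'a \<Rightarrow> real)" where
  "deleeuw f = (\<lambda>(x,y). (f x - f y) / dist x y)"

definition deleeuw_adj :: "((('a::metric_space \<times> 'a) \<Rightarrow> real) \<Rightarrow> real) measure \<Rightarrow> ('a \<Rightarrow> real) \<Rightarrow> real" where
  "deleeuw_adj \<mu> f = (\<integral>\<zeta>. \<zeta> (deleeuw f) \<partial>\<mu>)"

definition radon_on :: "'b::topological_space set \<Rightarrow> 'b measure \<Rightarrow> bool" where
  "radon_on K \<mu> \<longleftrightarrow> sets \<mu> = sets (restrict_space borel K) \<and> space \<mu> = K \<and>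
     finite_measure \<mu> \<and>
     (\<forall>B\<in>sets \<mu>. emeasure \<mu> B = (SUP C\<in>{C. compact C \<and> C \<subseteq> B}. emeasure \<mu> C))"

end

theory Submission
  imports Defs
begin

text \<open>Let \<open>g = 1/(1 + d)\<close>, so that \<open>1 + l g\<close> turns the De Leeuw transform for \<open>d\<close> into the one for the
  metric \<open>d + l d/(1 + d)\<close>. Among the optimal positive functionals representing \<open>m\<close>, Hahn--Banach gives
  one, \<open>L\<close>, with \<open>L g\<close> at most the rate \<open>r\<close> at which the norm of \<open>m\<close> for this metric grows in \<open>l\<close>.
  Take a function that nearly attains \<open>r\<close>, restrict it to a finite set \<open>F\<close> almost supporting \<open>m\<close>, and
  extend it back by a McShane formula. Strict concavity of \<open>t/(1 + t)\<close> leaves slack at every pair with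
  a coordinate far from \<open>F\<close>, so \<open>L\<close> gives little mass to such pairs; mass at long distances is excluded by
  truncating a nearly norming function. After passing to the Riesz measure on the compactification,
  almost every point is the limit of a filter whose coordinates are Cauchy, and completeness puts
  these coordinates in \<open>M\<close>.\<close>

section \<open>A Hahn--Banach theorem for cones of constraints\<close>

text \<open>Positivity and optimality do not keep the mass over M x M, so a selection among the
  optimal functionals is needed. The weight 1/(1 + d) comes from transport: an elementary molecule
  (delta x - delta y)/d(x,y) with coefficient c moves c/d(x,y) units from one point to the other, so
  \<open>L 1\<close> charges d per unit and \<open>L decay\<close> charges d/(1 + d). Breaking a
  move at a point metrically between x and y leaves the first cost unchanged but strictly raises the
  second. Minimising the second cost among the minimisers of the first thus discourages detours
  through points away from those that carry m.

  Since \<open>rate\<close> is only a supremum and m is only almost finitely supported, all errors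
  must be small compared with l; hence l is fixed before the finite set F. The resulting estimate
  carries the factor \<open>decay\<close>, which fades at long distances, and so these pairs need a
  separate argument. Pairs at short distances need none: a point over the diagonal of M x M is
  allowed.\<close>

text \<open>A pair \<open>(u, c)\<close> stands for the demand \<open>L u \<le> c\<close> on an
  unknown linear \<open>L\<close>. Totality, applied to u and - u, bounds each value from both
  sides; the last clause excludes the contradiction 0 = L 0 \<le> c < 0. With sets of pairs, Zorn's
  lemma applies to plain inclusion.\<close>

definition constraint_cone :: "('b \<Rightarrow> real) set \<Rightarrow> (('b \<Rightarrow> real) \<times> real) set \<Rightarrow> bool" where
  "constraint_cone V S \<longleftrightarrow>
     (\<forall>u c. (u, c) \<in> S \<longrightarrow> u \<in> V) \<and>
     (\<forall>u c v e s t. (u, c) \<in> S \<longrightarrow> (v, e) \<in> S \<longrightarrow> 0 \<le> s \<longrightarrow> 0 \<le> t \<longrightarrow>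
        ((\<lambda>x. s * u x + t * v x), s * c + t * e) \<in> S) \<and>
     (\<forall>u\<in>V. \<exists>c. (u, c) \<in> S) \<and>
     (\<forall>c. ((\<lambda>_. 0), c) \<in> S \<longrightarrow> 0 \<le> c)"

lemma
  assumes "constraint_cone V S"
  shows constraint_coneD: "(u, c) \<in> S \<Longrightarrow> u \<in> V"
    and constraint_cone_comb: "\<lbrakk>(u, c) \<in> S; (v, e) \<in> S; 0 \<le> s; 0 \<le> t\<rbrakk> \<Longrightarrow>
        ((\<lambda>x. s * u x + t * v x), s * c + t * e) \<in> S"
    and constraint_cone_total: "u \<in> V \<Longrightarrow> \<exists>c. (u, c) \<in> S"
    and constraint_cone_pos: "((\<lambda>_. 0), c) \<in> S \<Longrightarrow> 0 \<le> c"
  using assms unfolding constraint_cone_def by blast+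

lemma maximal_constraint_cone:
  assumes "constraint_cone V S"
  obtains T where "S \<subseteq> T" "constraint_cone V T"
    "\<And>T'. T \<subseteq> T' \<Longrightarrow> constraint_cone V T' \<Longrightarrow> T' = T"
proof -
  let ?A = "{T. S \<subseteq> T \<and> constraint_cone V T}"
  have "\<exists>M\<in>?A. \<forall>X\<in>?A. M \<subseteq> X \<longrightarrow> X = M"
  proof (rule subset_Zorn_nonempty)
    show "?A \<noteq> {}" using assms by blast
  next
    fix C assume ne: "C \<noteq> {}" and ch: "subset.chain ?A C"
    have C: "S \<subseteq> T \<and> constraint_cone V T" if "T \<in> C" for T
      using ch that unfolding subset.chain_def by blast
    have lin: "T \<subseteq> T' \<or> T' \<subseteq> T" if "T \<in> C" "T' \<in> C" for T T'
      using ch that unfolding subset_chain_def by blast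
    obtain T0 where T0: "T0 \<in> C" using ne by blast
    have "constraint_cone V (\<Union>C)"
      unfolding constraint_cone_def
    proof (intro conjI allI impI ballI)
      fix u c v e and s t :: real
      assume "(u, c) \<in> \<Union>C" "(v, e) \<in> \<Union>C" and st: "0 \<le> s" "0 \<le> t"
      then obtain T T' where T: "T \<in> C" "T' \<in> C" "(u, c) \<in> T" "(v, e) \<in> T'" by blast
      then obtain U where "U \<in> C" "(u, c) \<in> U" "(v, e) \<in> U" using lin by blast
      then show "((\<lambda>x. s * u x + t * v x), s * c + t * e) \<in> \<Union>C"
        using C st constraint_cone_comb by blast
    next
      fix u c assume "(u, c) \<in> \<Union>C"
      then show "u \<in> V" using C constraint_coneD by blast
    next
      fix u assume "u \<in> V"
      then show "\<exists>c. (u, c) \<in> \<Union>C" using C[OF T0] T0 constraint_cone_total by blast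
    next
      fix c assume "((\<lambda>_. 0), c) \<in> \<Union>C"
      then show "0 \<le> c" using C constraint_cone_pos by blast
    qed
    then show "\<Union>C \<in> ?A" using C T0 by blast
  qed
  then obtain M where "M \<in> ?A" and M: "\<forall>X\<in>?A. M \<subseteq> X \<longrightarrow> X = M" by (elim bexE)
  then have SM: "S \<subseteq> M" "constraint_cone V M" by simp_all
  show thesis
  proof (rule that[OF SM])
    fix T' assume "M \<subseteq> T'" "constraint_cone V T'"
    then show "T' = M" using M SM by simp
  qed
qed

text \<open>The form of Hahn--Banach used here: in a maximal cone of constraints \<open>L u \<le> c\<close> every
  value \<open>L u\<close> is determined, because adding a constraint not in the cone makes it infeasible.\<close>

lemma constraint_cone_functional:
  assumes V: "\<And>f g a b. f \<in> V \<Longrightarrow> g \<in> V \<Longrightarrow> (\<lambda>x. a * f x + b * g x) \<in> V"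
    and S: "constraint_cone V S"
  obtains L :: "('b \<Rightarrow> real) \<Rightarrow> real"
  where "\<And>f g a b. f \<in> V \<Longrightarrow> g \<in> V \<Longrightarrow> L (\<lambda>x. a * f x + b * g x) = a * L f + b * L g"
    and "\<And>u c. (u, c) \<in> S \<Longrightarrow> L u \<le> c"
proof -
  obtain M where SM: "S \<subseteq> M" and M: "constraint_cone V M"
    and max: "\<And>T. M \<subseteq> T \<Longrightarrow> constraint_cone V T \<Longrightarrow> T = M"
    using maximal_constraint_cone[OF S] by blast
  note comb = constraint_cone_comb[OF M] and pos = constraint_cone_pos[OF M]
    and tot = constraint_cone_total[OF M] and MV = constraint_coneD[OF M]
  have scale: "((\<lambda>x. s * u x), s * c) \<in> M" if "(u, c) \<in> M" "0 \<le> s" for u c s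
    using comb[OF that(1) that(1) that(2), of 0] by simp
  \<comment> \<open>\<open>T\<close> is the cone generated by \<open>M\<close> and the demand
    \<open>L u \<le> c\<close>. By maximality it is not a constraint cone, and only its consistency
    can fail; rescaling the contradiction gives a demand in \<open>M\<close> that amounts to L u >
    c.\<close>
  have dual: "\<exists>s < -c. ((\<lambda>x. - u x), s) \<in> M" if u: "u \<in> V" and nin: "(u, c) \<notin> M" for u c
  proof -
    define T where "T = {((\<lambda>x. w x + t * u x), e + t * c) | w e t. (w, e) \<in> M \<and> 0 \<le> t}"
    have TI: "((\<lambda>x. w x + t * u x), e + t * c) \<in> T" if "(w, e) \<in> M" "0 \<le> t" for w e t
      using that unfolding T_def by blast
    have "M \<subseteq> T"
    proof clarify
      fix w e assume "(w, e) \<in> M"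
      from TI[OF this, of 0] show "(w, e) \<in> T" by simp
    qed
    obtain c0 where "(u, c0) \<in> M" using tot[OF u] by blast
    from TI[OF scale[OF this, of 0], of 1] have "(u, c) \<in> T" by simp
    then have "\<not> constraint_cone V T" using max[OF \<open>M \<subseteq> T\<close>] nin by blast
    moreover have "w \<in> V" if "(w, e) \<in> T" for w e
    proof -
      from that obtain w' e' t where "(w', e') \<in> M" "w = (\<lambda>x. w' x + t * u x)"
        unfolding T_def by blast
      then show ?thesis using V[OF MV u, of w' e' 1 t] by simp
    qed
    moreover have "((\<lambda>x. s * w x + t * v x), s * e + t * e') \<in> T"
      if "(w, e) \<in> T" "(v, e') \<in> T" "0 \<le> s" "0 \<le> t" for w e v e' s t
    proof -
      from that obtain w1 e1 t1 w2 e2 t2 where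
        1: "(w1, e1) \<in> M" "w = (\<lambda>x. w1 x + t1 * u x)" "e = e1 + t1 * c" "0 \<le> t1" and
        2: "(w2, e2) \<in> M" "v = (\<lambda>x. w2 x + t2 * u x)" "e' = e2 + t2 * c" "0 \<le> t2"
        unfolding T_def by blast
      have "((\<lambda>x. (s * w1 x + t * w2 x) + (s * t1 + t * t2) * u x),
             (s * e1 + t * e2) + (s * t1 + t * t2) * c) \<in> T"
        using 1 2 that by (intro TI comb) auto
      then show ?thesis unfolding 1 2 by (simp add: algebra_simps)
    qed
    moreover have "\<exists>c. (w, c) \<in> T" if "w \<in> V" for w
      using tot[OF that] \<open>M \<subseteq> T\<close> by blast
    ultimately obtain e0 where "((\<lambda>_. 0), e0) \<in> T" "e0 < 0"
      unfolding constraint_cone_def using not_le by blast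
    then obtain w e t where w: "(w, e) \<in> M" "(\<lambda>_. 0) = (\<lambda>x. w x + t * u x)" "e + t * c < 0" "0 \<le> t"
      unfolding T_def by blast
    have weq: "w x = - t * u x" for x using fun_cong[OF w(2), of x] by simp
    have "t \<noteq> 0"
    proof
      assume "t = 0"
      then have "w = (\<lambda>_. 0)" using weq by auto
      then show False using w pos[of e] \<open>t = 0\<close> by simp
    qed
    then have t: "t > 0" using w by simp
    have "((\<lambda>x. (1/t) * w x), (1/t) * e) \<in> M" using scale[OF w(1), of "1/t"] t by simp
    moreover have "(\<lambda>x. (1/t) * w x) = (\<lambda>x. - u x)" using weq t by auto
    moreover have "(1/t) * e < -c" using w(3) t by (simp add: field_simps)
    ultimately show ?thesis by auto
  qed
  \<comment> \<open>Upward closure comes from maximality: if the weaker demand were missing,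
    \<open>dual\<close> would produce a demand that contradicts \<open>(u, c)\<close>.\<close>
  have up: "(u, c') \<in> M" if uc: "(u, c) \<in> M" and cc: "c \<le> c'" for u c c'
  proof (rule ccontr)
    assume "(u, c') \<notin> M"
    then obtain s where s: "s < -c'" "((\<lambda>x. - u x), s) \<in> M" using dual MV[OF uc] by blast
    from comb[OF uc s(2), of 1 1] have "0 \<le> c + s" by (intro pos) simp
    then show False using s cc by simp
  qed
  \<comment> \<open>\<open>P u r\<close> says that \<open>M\<close> forces L u = r. The slack
    \<open>e\<close> makes an infimum of bounds usable without showing that it is attained.\<close>
  define P where "P u r \<longleftrightarrow> (\<forall>e>0. (u, r + e) \<in> M \<and> ((\<lambda>x. - u x), - r + e) \<in> M)" for u r
  have uniq: "r = r'" if "P u r" "P u r'" for u r r'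
  proof -
    have "a \<le> b" if "P u a" "P u b" for a b
    proof (rule field_le_epsilon)
      fix e :: real assume "e > 0"
      then have "(u, b + e/2) \<in> M" "((\<lambda>x. - u x), - a + e/2) \<in> M"
        using that unfolding P_def by auto
      from comb[OF this, of 1 1] have "0 \<le> (b + e/2) + (-a + e/2)" by (intro pos) simp
      then show "a \<le> b + e" by simp
    qed
    then show ?thesis using that by (meson antisym)
  qed
  have ex: "\<exists>r. P u r" if u: "u \<in> V" for u
  proof -
    have neg: "(\<lambda>x. - u x) \<in> V" using V[OF u u, of "-1" 0] by simp
    obtain s0 where s0: "((\<lambda>x. - u x), s0) \<in> M" using tot[OF neg] by blast
    obtain c0 where c0: "(u, c0) \<in> M" using tot[OF u] by blast
    have bdd: "bdd_below {c. (u, c) \<in> M}"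
    proof (rule bdd_belowI)
      fix c assume "c \<in> {c. (u, c) \<in> M}"
      from comb[OF this[simplified] s0, of 1 1] have "0 \<le> c + s0" by (intro pos) simp
      then show "- s0 \<le> c" by simp
    qed
    define q where "q = Inf {c. (u, c) \<in> M}"
    have "P u q" unfolding P_def
    proof (intro allI impI conjI)
      fix e :: real assume e: "e > 0"
      obtain c where "(u, c) \<in> M" "c < q + e"
        using cInf_lessD[of "{c. (u, c) \<in> M}" "q + e"] c0 e unfolding q_def by auto
      then show "(u, q + e) \<in> M" using up by fastforce
      \<comment> \<open>A demand below the infimum is absent from \<open>M\<close>, so
        \<open>dual\<close> supplies the matching lower bound on L u.\<close>
      have "(u, q - e) \<notin> M"
        using cInf_lower[OF _ bdd, of "q - e"] e unfolding q_def by auto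
      then show "((\<lambda>x. - u x), - q + e) \<in> M" using dual[OF u] up by fastforce
    qed
    then show ?thesis by blast
  qed
  define L where "L u = (THE r. P u r)" for u
  have L: "P u (L u)" if "u \<in> V" for u
    unfolding L_def using ex[OF that] uniq by (metis theI)
  have Pneg: "P (\<lambda>x. - u x) (- r)" if "P u r" for u r
    using that unfolding P_def by simp
  have Pscale_pos: "P (\<lambda>x. a * u x) (a * r)" if "P u r" "a > 0" for u r a
    unfolding P_def
  proof (intro allI impI conjI)
    fix e :: real assume "e > 0"
    then have *: "(u, r + e / a) \<in> M" "((\<lambda>x. - u x), - r + e / a) \<in> M"
      using that unfolding P_def by auto
    show "((\<lambda>x. a * u x), a * r + e) \<in> M" "((\<lambda>x. - (a * u x)), - (a * r) + e) \<in> M"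
      using scale[OF *(1), of a] scale[OF *(2), of a] that by (simp_all add: algebra_simps)
  qed
  have Padd: "P (\<lambda>x. u x + v x) (r + s)" if "P u r" "P v s" for u v r s
    unfolding P_def
  proof (intro allI impI conjI)
    fix e :: real assume e: "e > 0"
    then have "e/2 > 0" by simp
    with that have *: "(u, r + e / 2) \<in> M" "((\<lambda>x. - u x), - r + e / 2) \<in> M"
      "(v, s + e / 2) \<in> M" "((\<lambda>x. - v x), - s + e / 2) \<in> M"
      unfolding P_def by blast+
    show "((\<lambda>x. u x + v x), r + s + e) \<in> M" "((\<lambda>x. - (u x + v x)), - (r + s) + e) \<in> M"
      using comb[OF *(1) *(3), of 1 1] comb[OF *(2) *(4), of 1 1] by (simp_all add: algebra_simps)
  qed
  have Pscale: "P (\<lambda>x. a * u x) (a * r)" if u: "P u r" for u r a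
  proof (cases a "0 :: real" rule: linorder_cases)
    case less
    then show ?thesis using Pneg[OF Pscale_pos[OF u, of "-a"]] by simp
  next
    case equal
    then show ?thesis using Padd[OF u Pneg[OF u]] by simp
  next
    case greater
    then show ?thesis using Pscale_pos[OF u] by simp
  qed
  show thesis
  proof
    fix f g a b assume fg: "f \<in> V" "g \<in> V"
    show "L (\<lambda>x. a * f x + b * g x) = a * L f + b * L g"
      by (rule uniq[OF L[OF V[OF fg]] Padd[OF Pscale[OF L[OF fg(1)]] Pscale[OF L[OF fg(2)]]]])
  next
    fix u c assume uc: "(u, c) \<in> S"
    then have uc: "(u, c) \<in> M" using SM by blast
    show "L u \<le> c"
    proof (rule field_le_epsilon)
      fix e :: real assume "e > 0"
      then have "((\<lambda>x. - u x), - L u + e) \<in> M" using L[OF MV[OF uc]] unfolding P_def by blast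
      from comb[OF uc this, of 1 1] have "0 \<le> c + (- L u + e)" by (intro pos) simp
      then show "L u \<le> c + e" by simp
    qed
  qed
qed

section \<open>The Riesz representation theorem on a compact Hausdorff space\<close>

locale positive_functional =
  fixes K :: "'b::topological_space set" and L :: "('b \<Rightarrow> real) \<Rightarrow> real"
  assumes compact_K: "compact K"
    and Hausdorff_K: "Hausdorff_space (top_of_set K)"
    and L_linear: "\<And>f g a b. continuous_on K f \<Longrightarrow> continuous_on K g \<Longrightarrow>
          L (\<lambda>x. a * f x + b * g x) = a * L f + b * L g"
    and L_nonneg: "\<And>f. continuous_on K f \<Longrightarrow> (\<And>x. x \<in> K \<Longrightarrow> 0 \<le> f x) \<Longrightarrow> 0 \<le> L f"
begin

lemma L_mono:
  assumes "continuous_on K f" "continuous_on K g" "\<And>x. x \<in> K \<Longrightarrow> f x \<le> g x"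
  shows "L f \<le> L g"
proof -
  have "0 \<le> L (\<lambda>x. 1 * g x + (-1) * f x)"
    using assms by (intro L_nonneg continuous_intros) auto
  also have "\<dots> = L g - L f" using L_linear[OF assms(2,1), of 1 "-1"] by simp
  finally show ?thesis by simp
qed

lemma L_add: "continuous_on K f \<Longrightarrow> continuous_on K g \<Longrightarrow> L (\<lambda>x. f x + g x) = L f + L g"
  using L_linear[of f g 1 1] by simp

lemma L_scale: "continuous_on K f \<Longrightarrow> L (\<lambda>x. a * f x) = a * L f"
  using L_linear[of f f a 0] by simp

lemma L_zero: "L (\<lambda>x. 0) = 0"
  using L_scale[of "\<lambda>_. 0" 0] by simp

lemma L_sum:
  assumes "finite I" "\<And>i. i \<in> I \<Longrightarrow> continuous_on K (f i)"
  shows "L (\<lambda>x. \<Sum>i\<in>I. f i x) = (\<Sum>i\<in>I. L (f i))"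
  using assms
proof (induction I rule: finite_induct)
  case empty
  then show ?case using L_zero by simp
next
  case (insert i I)
  then show ?case by (simp add: L_add continuous_on_sum)
qed

text \<open>Vanishing outside \<open>U\<close> is weaker than having compact support in
  \<open>U\<close>. In place of compact support, the sets {f \<ge> e} with e > 0 are compact and lie
  in \<open>U\<close>, at the price of an error e * L 1.\<close>

definition sub_indicators :: "'b set \<Rightarrow> ('b \<Rightarrow> real) set" where
  "sub_indicators U = {f. continuous_on K f \<and> (\<forall>x\<in>K. 0 \<le> f x \<and> f x \<le> 1) \<and> (\<forall>x\<in>K - U. f x = 0)}"

definition content :: "'b set \<Rightarrow> real" where
  "content U = (SUP f\<in>sub_indicators U. L f)"

definition mu :: "'b set \<Rightarrow> ennreal" where
  "mu A = (INF U\<in>{U. open U \<and> A \<subseteq> U}. ennreal (content U))"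

lemma zero_sub_indicator: "(\<lambda>x. 0) \<in> sub_indicators U"
  by (simp add: sub_indicators_def)

lemma bdd_content: "bdd_above (L ` sub_indicators U)"
proof (rule bdd_aboveI2)
  fix f assume "f \<in> sub_indicators U"
  then show "L f \<le> L (\<lambda>_. 1)" by (intro L_mono) (auto simp: sub_indicators_def)
qed

lemma content_upper: "f \<in> sub_indicators U \<Longrightarrow> L f \<le> content U"
  unfolding content_def by (rule cSUP_upper[OF _ bdd_content])

lemma content_least: "(\<And>f. f \<in> sub_indicators U \<Longrightarrow> L f \<le> c) \<Longrightarrow> content U \<le> c"
  unfolding content_def using zero_sub_indicator by (intro cSUP_least) auto

lemma content_nonneg: "0 \<le> content U"
  using content_upper[OF zero_sub_indicator] L_zero by simp

lemma content_mono: "K \<inter> U \<subseteq> V \<Longrightarrow> content U \<le> content V"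
  by (intro content_least content_upper) (auto simp: sub_indicators_def)

lemma content_UNIV: "content UNIV = L (\<lambda>_. 1)"
  by (intro antisym content_least content_upper L_mono) (auto simp: sub_indicators_def)

lemma Urysohn_sub_indicator:
  assumes "open U" "x \<in> K" "x \<in> U"
  obtains g where "g \<in> sub_indicators U" "g x = 1"
proof -
  have "completely_regular_space (top_of_set K)"
    using compact_K Hausdorff_K
    by (simp add: compact_Hausdorff_or_regular_imp_normal_space Hausdorff_imp_t1_space
        normal_imp_completely_regular_space compact_space_subtopology)
  moreover have "closedin (top_of_set K) (K - U)"
    using assms(1) by (auto simp: closedin_def openin_open)
  ultimately obtain f where f: "continuous_map (top_of_set K) (top_of_set {0..1}) f"
     "f x = (0::real)" "f ` (K - U) \<subseteq> {1}"
    using assms unfolding completely_regular_space_def by force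
  then have cf: "continuous_on K f" and ran: "f ` K \<subseteq> {0..1}"
    by (auto simp: continuous_map_in_subtopology)
  have "(\<lambda>y. 1 - f y) \<in> sub_indicators U"
    unfolding sub_indicators_def
  proof (intro CollectI conjI ballI)
    show "continuous_on K (\<lambda>y. 1 - f y)" by (intro continuous_on_diff continuous_on_const cf)
    show "0 \<le> 1 - f y" "1 - f y \<le> 1" if "y \<in> K" for y using ran that by force+
    show "1 - f y = 0" if "y \<in> K - U" for y using f(3) that by force
  qed
  then show thesis using that[of "\<lambda>y. 1 - f y"] f(2) by simp
qed

lemma compact_superlevel:
  fixes f :: "'b \<Rightarrow> real"
  assumes "continuous_on K f"
  shows "compact {x\<in>K. e \<le> f x}"
proof -
  have "closedin (top_of_set K) (K \<inter> f -` {e..})"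
    using assms by (intro continuous_closedin_preimage) auto
  then obtain T where "closed T" "K \<inter> f -` {e..} = T \<inter> K"
    by (auto simp: closedin_closed)
  then have "{x\<in>K. e \<le> f x} = K \<inter> T" by auto
  then show ?thesis using compact_Int_closed[OF compact_K \<open>closed T\<close>] by simp
qed

text \<open>Around each point of the compact set {f \<ge> e} there is a bump function that vanishes
  off one of the \<open>U n\<close>. Finitely many of the sets {bump > 1/2} cover it, which bounds f
  by e plus a finite sum of sub-indicators of the \<open>U i\<close>.\<close>

lemma content_subadditive:
  fixes U :: "nat \<Rightarrow> 'b set"
  assumes U: "\<And>n. open (U n)"
  shows "ennreal (content (\<Union>n. U n)) \<le> (\<Sum>n. ennreal (content (U n)))"
proof (cases "(\<Sum>n. ennreal (content (U n))) = top")
  case False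
  then obtain s where s: "s \<ge> 0" "(\<Sum>n. ennreal (content (U n))) = ennreal s"
    by (cases "(\<Sum>n. ennreal (content (U n)))") auto
  have fin: "(\<Sum>n\<in>I. content (U n)) \<le> s" if "finite I" for I
  proof -
    have "ennreal (\<Sum>n\<in>I. content (U n)) = (\<Sum>n\<in>I. ennreal (content (U n)))"
      by (simp add: content_nonneg sum_ennreal)
    also have "\<dots> \<le> ennreal s"
      unfolding s(2)[symmetric] using that by (intro sum_le_suminf) auto
    finally show ?thesis using s(1) by simp
  qed
  have "content (\<Union>n. U n) \<le> s"
  proof (rule content_least)
    fix f assume f: "f \<in> sub_indicators (\<Union>n. U n)"
    have step: "L f \<le> s + e * L (\<lambda>_. 1)" if e: "e > 0" for e
    proof -
      let ?C = "{x\<in>K. e \<le> f x}"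
      have cf: "continuous_on K f" using f by (simp add: sub_indicators_def)
      have "\<exists>n g. x \<in> U n \<and> g \<in> sub_indicators (U n) \<and> g x = 1" if "x \<in> ?C" for x
      proof -
        have "x \<in> (\<Union>n. U n)" using that e f unfolding sub_indicators_def by force
        then obtain n where "x \<in> U n" by blast
        then show ?thesis using Urysohn_sub_indicator[OF U, of x n] that by blast
      qed
      then obtain n g where ng: "\<And>x. x \<in> ?C \<Longrightarrow> x \<in> U (n x) \<and> g x \<in> sub_indicators (U (n x)) \<and> g x x = 1"
        by metis
      have cg: "continuous_on K (g x)" and g0: "\<And>y. y \<in> K \<Longrightarrow> 0 \<le> g x y"
        and gU: "\<And>y. y \<in> K \<Longrightarrow> y \<notin> U (n x) \<Longrightarrow> g x y = 0" if "x \<in> ?C" for x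
        using ng[OF that] by (auto simp: sub_indicators_def)
      have "\<exists>G. open G \<and> G \<inter> K = (g x) -` {1/2<..} \<inter> K" if "x \<in> ?C" for x
        by (rule continuous_on_open_invariant[THEN iffD1, rule_format, OF cg[OF that] open_greaterThan])
      then have "\<forall>x\<in>?C. \<exists>G. open G \<and> G \<inter> K = (g x) -` {1/2<..} \<inter> K" by blast
      from bchoice[OF this] obtain G
        where G: "\<And>x. x \<in> ?C \<Longrightarrow> open (G x) \<and> G x \<inter> K = (g x) -` {1/2<..} \<inter> K"
        by blast
      have "?C \<subseteq> (\<Union>x\<in>?C. G x)"
      proof
        fix x assume x: "x \<in> ?C"
        then have "x \<in> G x \<inter> K" using G[OF x] ng[OF x] by auto
        then show "x \<in> (\<Union>x\<in>?C. G x)" using x by blast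
      qed
      then obtain D where D: "D \<subseteq> ?C" "finite D" "?C \<subseteq> (\<Union>x\<in>D. G x)"
        using compactE_image[OF compact_superlevel[OF cf], of ?C G] G by blast
      \<comment> \<open>Grouping the bumps by index charges each \<open>U i\<close> only once. The
        factor 2 lifts values above 1/2 to at least 1, and \<open>min 1\<close> keeps the sum a
        sub-indicator.\<close>
      define h where "h i y = min 1 (\<Sum>x\<in>{x\<in>D. n x = i}. 2 * g x y)" for i y
      have sum0: "0 \<le> (\<Sum>x\<in>{x\<in>D. n x = i}. 2 * g x y)" if "y \<in> K" for i y
        using that D(1) g0 by (intro sum_nonneg) auto
      have ch: "continuous_on K (h i)" for i
        unfolding h_def using D(1) cg by (intro continuous_intros) auto
      have h: "h i \<in> sub_indicators (U i)" for i
      proof -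
        have "h i y = 0" if "y \<in> K - U i" for y
        proof -
          have "(\<Sum>x\<in>{x\<in>D. n x = i}. 2 * g x y) = 0"
            using that D(1) gU by (intro sum.neutral) auto
          then show ?thesis by (simp add: h_def)
        qed
        then show ?thesis using ch sum0 by (auto simp: sub_indicators_def h_def)
      qed
      have "L f \<le> L (\<lambda>y. e * 1 + 1 * (\<Sum>i\<in>n ` D. h i y))"
      proof (rule L_mono[OF cf])
        show "continuous_on K (\<lambda>y. e * 1 + 1 * (\<Sum>i\<in>n ` D. h i y))"
          using ch by (intro continuous_intros)
        fix y assume y: "y \<in> K"
        have h0: "0 \<le> h i y" for i using h[of i] y by (auto simp: sub_indicators_def)
        show "f y \<le> e * 1 + 1 * (\<Sum>i\<in>n ` D. h i y)"
        proof (cases "e \<le> f y")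
          case True
          then obtain x where x: "x \<in> D" "y \<in> G x" using D(3) y by blast
          then have "g x y > 1/2" using G[of x] y D(1) by blast
          then have "1 \<le> 2 * g x y" by simp
          also have "\<dots> \<le> (\<Sum>x\<in>{x'\<in>D. n x' = n x}. 2 * g x y)"
            using x D(1,2) g0 y by (intro member_le_sum) auto
          finally have "1 \<le> h (n x) y" by (simp add: h_def)
          also have "\<dots> \<le> (\<Sum>i\<in>n ` D. h i y)"
            using x D(2) h0 by (intro member_le_sum) auto
          finally show ?thesis using f y e by (force simp: sub_indicators_def)
        next
          case False
          then show ?thesis using h0 by (simp add: sum_nonneg add_increasing2)
        qed
      qed
      also have "\<dots> = e * L (\<lambda>_. 1) + (\<Sum>i\<in>n ` D. L (h i))"
        using ch D(2) by (subst L_linear) (auto intro!: continuous_intros simp: L_sum)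
      also have "(\<Sum>i\<in>n ` D. L (h i)) \<le> (\<Sum>i\<in>n ` D. content (U i))"
        using h by (intro sum_mono content_upper)
      also have "\<dots> \<le> s" using D(2) by (intro fin) auto
      finally show ?thesis by simp
    qed
    show "L f \<le> s"
    proof (rule field_le_epsilon)
      fix e :: real assume e: "e > 0"
      have L1: "0 \<le> L (\<lambda>_. 1)" by (intro L_nonneg) auto
      have "L f \<le> s + e / (1 + L (\<lambda>_. 1)) * L (\<lambda>_. 1)" using e L1 by (intro step) simp
      also have "e / (1 + L (\<lambda>_. 1)) * L (\<lambda>_. 1) \<le> e" using L1 e by (simp add: field_simps)
      finally show "L f \<le> s + e" by simp
    qed
  qed
  then show ?thesis using s by (simp add: ennreal_leI)
qed simp

lemma mu_le: "open U \<Longrightarrow> A \<subseteq> U \<Longrightarrow> mu A \<le> ennreal (content U)"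
  unfolding mu_def by (rule INF_lower) auto

lemma mu_open: "open U \<Longrightarrow> mu (K \<inter> U) = ennreal (content U)"
  by (intro antisym mu_le) (auto simp: mu_def intro!: INF_greatest ennreal_leI content_mono)

lemma mu_finite: "mu A \<noteq> top"
  using mu_le[of UNIV A] by (auto simp: top_unique)

lemma outer_measure_mu: "outer_measure_space (Pow K) mu"
  unfolding outer_measure_space_def
proof (intro conjI)
  have "content {} = 0"
  proof -
    have "L f \<le> 0" if "f \<in> sub_indicators {}" for f
      using that L_mono[of f "\<lambda>_. 0"] L_zero by (auto simp: sub_indicators_def)
    then show ?thesis using content_least content_nonneg by (meson antisym)
  qed
  then show "positive (Pow K) mu"
    using mu_open[of "{}"] by (simp add: positive_def)
  show "increasing (Pow K) mu"
    unfolding increasing_def mu_def by (auto intro!: INF_superset_mono)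
  show "countably_subadditive (Pow K) mu"
    unfolding countably_subadditive_def
  proof (intro allI impI)
    fix A :: "nat \<Rightarrow> 'b set"
    show "mu (\<Union>i. A i) \<le> (\<Sum>i. mu (A i))"
    proof (rule ennreal_le_epsilon)
      fix e :: real assume e: "0 < e"
      have "\<exists>U. open U \<and> A n \<subseteq> U \<and> ennreal (content U) < mu (A n) + e * (1/2) ^ Suc n" for n
      proof -
        have "mu (A n) < mu (A n) + e * (1/2) ^ Suc n"
          using e mu_finite[of "A n"] by (simp add: ennreal_zero_less_mult_iff less_top[symmetric])
        then show ?thesis unfolding mu_def by (auto simp: INF_less_iff)
      qed
      then obtain U where U: "\<And>n. open (U n)" "\<And>n. A n \<subseteq> U n"
        "\<And>n. ennreal (content (U n)) < mu (A n) + e * (1/2) ^ Suc n" by metis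
      have "mu (\<Union>i. A i) \<le> ennreal (content (\<Union>i. U i))"
        using U by (intro mu_le) auto
      also have "\<dots> \<le> (\<Sum>i. ennreal (content (U i)))" by (rule content_subadditive[OF U(1)])
      also have "\<dots> \<le> (\<Sum>i. mu (A i) + e * (1/2) ^ Suc i)"
        using U(3) by (intro suminf_le) (auto intro: less_imp_le)
      also have "\<dots> = (\<Sum>i. mu (A i)) + (\<Sum>i. ennreal e * ennreal ((1/2) ^ Suc i))"
        using e by (subst suminf_add[symmetric]) (simp_all add: ennreal_mult'[symmetric])
      also have "(\<Sum>i. ennreal e * ennreal ((1/2) ^ Suc i)) = e"
        unfolding ennreal_suminf_cmult
        by (subst suminf_ennreal_eq[OF zero_le_power power_half_series]) auto
      finally show "mu (\<Union>i. A i) \<le> (\<Sum>i. mu (A i)) + e" by simp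
    qed
  qed
qed

text \<open>For f vanishing off V \<inter> U, the set A - U lies in the open set V \<inter> {f < e}.
  A sub-indicator g of that set is positive only where f is below e, so (f + g)/(1 + e) is a
  sub-indicator of V. This bounds L f + L g by (1 + e) * content V, and e tends to 0.\<close>

lemma lambda_system_open:
  assumes U: "open U"
  shows "K \<inter> U \<in> lambda_system K (Pow K) mu"
proof -
  interpret sigma_algebra K "Pow K" by (rule sigma_algebra_Pow)
  have sub: "subadditive (Pow K) mu"
    using outer_measure_mu countably_subadditive_subadditive unfolding outer_measure_space_def by blast
  have "mu (A \<inter> (K \<inter> U)) + mu (A - K \<inter> U) = mu A" if A: "A \<subseteq> K" for A
  proof (rule antisym)
    have "mu ((A \<inter> (K \<inter> U)) \<union> (A - K \<inter> U)) \<le> mu (A \<inter> (K \<inter> U)) + mu (A - K \<inter> U)"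
      using A by (intro subadditiveD[OF sub]) auto
    then show "mu A \<le> mu (A \<inter> (K \<inter> U)) + mu (A - K \<inter> U)" by (simp add: Int_Diff_Un)
  next
    show "mu (A \<inter> (K \<inter> U)) + mu (A - K \<inter> U) \<le> mu A"
      unfolding mu_def[of A]
    proof (rule INF_greatest, clarify)
      fix V assume V: "open V" "A \<subseteq> V"
      obtain r where r: "0 \<le> r" "mu (A - K \<inter> U) = ennreal r"
        using mu_finite[of "A - K \<inter> U"] by (cases "mu (A - K \<inter> U)") auto
      have "content (V \<inter> U) \<le> content V - r"
      proof (rule content_least)
        fix f assume f: "f \<in> sub_indicators (V \<inter> U)"
        then have cf: "continuous_on K f" by (simp add: sub_indicators_def)
        have step: "r + L f \<le> (1 + e) * content V" if e: "e > 0" for e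
        proof -
          obtain W0 where W0: "open W0" "W0 \<inter> K = f -` {..<e} \<inter> K"
            using continuous_on_open_invariant[THEN iffD1, rule_format, OF cf open_lessThan] by auto
          have "A - K \<inter> U \<subseteq> V \<inter> W0"
          proof
            fix x assume x: "x \<in> A - K \<inter> U"
            then have "x \<in> K" "f x = 0" using A f by (auto simp: sub_indicators_def)
            then have "x \<in> W0 \<inter> K" unfolding W0(2) using e by simp
            then show "x \<in> V \<inter> W0" using x V by blast
          qed
          then have "ennreal r \<le> ennreal (content (V \<inter> W0))"
            unfolding r(2)[symmetric] using V W0 by (intro mu_le) auto
          then have "r \<le> content (V \<inter> W0)" by (simp add: content_nonneg)
          also have "\<dots> \<le> (1 + e) * content V - L f"
          proof (rule content_least)
            fix g assume g: "g \<in> sub_indicators (V \<inter> W0)"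
            then have cg: "continuous_on K g" by (simp add: sub_indicators_def)
            have "(\<lambda>x. 1 / (1 + e) * f x + 1 / (1 + e) * g x) \<in> sub_indicators V"
              unfolding sub_indicators_def
            proof (intro CollectI conjI ballI)
              show "continuous_on K (\<lambda>x. 1 / (1 + e) * f x + 1 / (1 + e) * g x)"
                using cf cg by (intro continuous_intros)
              fix x assume x: "x \<in> K"
              show "0 \<le> 1 / (1 + e) * f x + 1 / (1 + e) * g x"
                using f g x e by (simp add: sub_indicators_def)
              have "f x + g x \<le> 1 + e"
              proof (cases "x \<in> W0")
                case True
                then have "f x < e" using W0(2) x by blast
                moreover have "g x \<le> 1" using g x by (simp add: sub_indicators_def)
                ultimately show ?thesis by simp
              next
                case False
                then have "g x = 0" "f x \<le> 1" using f g x by (simp_all add: sub_indicators_def)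
                then show ?thesis using e by simp
              qed
              then show "1 / (1 + e) * f x + 1 / (1 + e) * g x \<le> 1"
                using e by (simp add: add_divide_distrib[symmetric])
            next
              fix x assume "x \<in> K - V"
              then show "1 / (1 + e) * f x + 1 / (1 + e) * g x = 0"
                using f g by (simp add: sub_indicators_def)
            qed
            from content_upper[OF this]
            have "1 / (1 + e) * L f + 1 / (1 + e) * L g \<le> content V"
              by (simp only: L_linear[OF cf cg])
            then show "L g \<le> (1 + e) * content V - L f" using e
              by (simp add: add_divide_distrib[symmetric] pos_divide_le_eq algebra_simps)
          qed
          finally show ?thesis by simp
        qed
        have "r + L f \<le> content V"
        proof (rule field_le_epsilon)
          fix e :: real assume e: "e > 0"
          have "r + L f \<le> (1 + e / (1 + content V)) * content V" using e content_nonneg[of V] by (intro step) simp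
          also have "\<dots> \<le> content V + e" using content_nonneg[of V] e by (simp add: field_simps)
          finally show "r + L f \<le> content V + e" .
        qed
        then show "L f \<le> content V - r" by simp
      qed
      moreover have "mu (A \<inter> (K \<inter> U)) \<le> ennreal (content (V \<inter> U))"
        using U V by (intro mu_le) auto
      ultimately have "mu (A \<inter> (K \<inter> U)) + mu (A - K \<inter> U) \<le> ennreal (content (V \<inter> U)) + ennreal r"
        and "content (V \<inter> U) + r \<le> content V"
        using r by (simp_all add: add_right_mono)
      then show "mu (A \<inter> (K \<inter> U)) + mu (A - K \<inter> U) \<le> ennreal (content V)"
        using r content_nonneg[of "V \<inter> U"]
        by (metis ennreal_plus ennreal_leI order_trans)
    qed
  qed
  then show ?thesis unfolding lambda_system_eq by simp
qed

section \<open>The Borel measure obtained from \<open>mu\<close> and its regularity\<close>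

definition riesz_measure :: "'b measure" where
  "riesz_measure = measure_of K (sets (restrict_space borel K)) mu"

lemma space_riesz_measure: "space riesz_measure = K"
  and sets_riesz_measure: "sets riesz_measure = sets (restrict_space borel K)"
proof -
  have "sets (restrict_space borel K) \<subseteq> Pow K"
    using sets.space_closed[of "restrict_space borel K"] by (simp add: space_restrict_space)
  moreover have "sigma_algebra K (sets (restrict_space borel K))"
    using sets.sigma_algebra_axioms[of "restrict_space borel K"] by (simp add: space_restrict_space)
  ultimately show "space riesz_measure = K"
      "sets riesz_measure = sets (restrict_space borel K)"
    unfolding riesz_measure_def
    by (simp_all add: space_measure_of sigma_algebra.sigma_sets_eq sets_measure_of)
qed

text \<open>\<open>measure_of\<close> yields the null measure unless \<open>mu\<close> is countably
  additive on the Borel sets. It is so on the Caratheodory-measurable sets, a sigma-algebra that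
  contains the relatively open sets.\<close>

lemma emeasure_riesz_measure:
  assumes "B \<in> sets riesz_measure"
  shows "emeasure riesz_measure B = mu B"
proof -
  interpret Pow: sigma_algebra K "Pow K" by (rule sigma_algebra_Pow)
  have ms: "measure_space K (lambda_system K (Pow K) mu) mu"
    by (rule Pow.caratheodory_lemma[OF outer_measure_mu])
  then interpret lam: sigma_algebra K "lambda_system K (Pow K) mu"
    by (simp add: measure_space_def)
  have "K \<inter> B \<in> lambda_system K (Pow K) mu" if "B \<in> sigma_sets UNIV {S. open S}" for B
    using that
  proof (induction rule: sigma_sets.induct)
    case (Basic a)
    then show ?case using lambda_system_open by simp
  next
    case Empty
    then show ?case by simp
  next
    case (Compl a)
    have "K \<inter> (UNIV - a) = K - (K \<inter> a)" by blast
    then show ?case using lam.compl_sets[OF Compl.IH] by simp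
  next
    case (Union a)
    have "(\<Union>i. K \<inter> a i) \<in> lambda_system K (Pow K) mu"
      using Union.IH by (intro lam.countable_UN) auto
    then show ?case by (simp only: Int_UN_distrib)
  qed
  then have sub: "sets (restrict_space borel K) \<subseteq> lambda_system K (Pow K) mu"
    by (auto simp: sets_restrict_space borel_def)
  have sa: "sigma_algebra K (sets (restrict_space borel K))"
    using sets.sigma_algebra_axioms[of "restrict_space borel K"] by (simp add: space_restrict_space)
  have "measure_space K (sets (restrict_space borel K)) mu"
    by (rule measure_down[OF ms sa sub])
  then show ?thesis
    using assms unfolding sets_riesz_measure unfolding riesz_measure_def
    by (intro emeasure_measure_of_sigma) (auto simp: measure_space_def)
qed

lemma finite_riesz_measure: "finite_measure riesz_measure"
  using emeasure_riesz_measure[OF sets.top] mu_finite by (intro finite_measureI) simp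

text \<open>Outer regularity is built into \<open>mu\<close>. Applied to K - B it gives an open
  \<open>U\<close>, and the compact set K - U approximates \<open>B\<close> from inside.\<close>

lemma radon_riesz_measure: "radon_on K riesz_measure"
  unfolding radon_on_def
proof (intro conjI ballI)
  interpret finite_measure riesz_measure by (rule finite_riesz_measure)
  fix B assume B: "B \<in> sets riesz_measure"
  then have BK: "B \<subseteq> K" using sets.sets_into_space space_riesz_measure by blast
  show "emeasure riesz_measure B = (SUP C\<in>{C. compact C \<and> C \<subseteq> B}. emeasure riesz_measure C)"
  proof (rule antisym)
    have "emeasure riesz_measure C \<le> emeasure riesz_measure B" if "C \<subseteq> B" for C
      using that B by (rule emeasure_mono)
    then show "(SUP C\<in>{C. compact C \<and> C \<subseteq> B}. emeasure riesz_measure C) \<le> emeasure riesz_measure B"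
      by (intro SUP_least) auto
    show "emeasure riesz_measure B \<le> (SUP C\<in>{C. compact C \<and> C \<subseteq> B}. emeasure riesz_measure C)"
    proof (rule ennreal_le_epsilon)
      fix e :: real assume e: "e > 0"
      have KB: "K - B \<in> sets riesz_measure" using B space_riesz_measure by (metis sets.compl_sets)
      have "mu (K - B) < mu (K - B) + ennreal e"
        using e mu_finite by (simp add: less_top[symmetric])
      then obtain U where U: "open U" "K - B \<subseteq> U" "ennreal (content U) < mu (K - B) + ennreal e"
        unfolding mu_def[of "K - B"] by (auto simp: INF_less_iff)
      have KU: "K \<inter> U \<in> sets riesz_measure"
        using U by (auto simp: sets_riesz_measure sets_restrict_space)
      have C: "compact (K - U)" by (rule compact_diff[OF compact_K U(1)])
      have "emeasure riesz_measure (K \<inter> U) \<le> emeasure riesz_measure (K - B) + ennreal e"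
        unfolding emeasure_riesz_measure[OF KB] emeasure_riesz_measure[OF KU] mu_open[OF U(1)]
        using U(3) by (rule less_imp_le)
      then have "measure riesz_measure (K \<inter> U) \<le> measure riesz_measure (K - B) + e"
        using e by (simp add: emeasure_eq_measure flip: ennreal_plus)
      moreover have "measure riesz_measure (K - B) = measure riesz_measure K - measure riesz_measure B"
        using B space_riesz_measure finite_measure_compl by metis
      moreover have "measure riesz_measure (K - K \<inter> U) = measure riesz_measure K - measure riesz_measure (K \<inter> U)"
        using KU space_riesz_measure finite_measure_compl by metis
      moreover have "K - K \<inter> U = K - U" by blast
      ultimately have "measure riesz_measure B \<le> measure riesz_measure (K - U) + e" by simp
      then have "emeasure riesz_measure B \<le> emeasure riesz_measure (K - U) + ennreal e"
        using e by (simp add: emeasure_eq_measure flip: ennreal_plus)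
      also have "emeasure riesz_measure (K - U) \<le> (SUP C\<in>{C. compact C \<and> C \<subseteq> B}. emeasure riesz_measure C)"
        using C U(2) BK by (intro SUP_upper) auto
      finally show "emeasure riesz_measure B
          \<le> (SUP C\<in>{C. compact C \<and> C \<subseteq> B}. emeasure riesz_measure C) + ennreal e"
        by simp
    qed
  qed
qed (auto simp: space_riesz_measure sets_riesz_measure finite_riesz_measure)

section \<open>Integrals of continuous functions\<close>

lemma measurable_riesz_measure:
  "continuous_on K f \<Longrightarrow> f \<in> borel_measurable riesz_measure"
  by (simp add: measurable_cong_sets[OF sets_riesz_measure refl]
      borel_measurable_continuous_on_restrict)

lemma integrable_riesz_measure:
  fixes f :: "'b \<Rightarrow> real"
  assumes "continuous_on K f"
  shows "integrable riesz_measure f"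
proof -
  interpret finite_measure riesz_measure by (rule finite_riesz_measure)
  have "bounded (f ` K)" using compact_continuous_image[OF assms compact_K] compact_imp_bounded by blast
  then obtain B where "\<And>x. x \<in> K \<Longrightarrow> norm (f x) \<le> B" by (auto simp: bounded_iff)
  then show ?thesis
    by (intro integrable_const_bound[of _ B] AE_I2 measurable_riesz_measure assms)
      (auto simp: space_riesz_measure)
qed

lemma measure_riesz_measure: "measure riesz_measure K = L (\<lambda>_. 1)"
  using emeasure_riesz_measure[of K] mu_open[of UNIV] space_riesz_measure content_nonneg[of UNIV]
  by (simp add: measure_def content_UNIV) (metis enn2real_ennreal sets.top)

text \<open>\<open>G\<close> mediates between the integral and \<open>L\<close>: u is at most c
  times its indicator, its measure is \<open>content G\<close>, and c times any sub-indicator of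
  \<open>G\<close> lies below w.\<close>

lemma integral_riesz_le:
  assumes u: "continuous_on K u" "\<And>x. x \<in> K \<Longrightarrow> u x \<le> c"
    and w: "continuous_on K w" "\<And>x. x \<in> K \<Longrightarrow> 0 \<le> w x"
    and G: "open G" "\<And>x. x \<in> K \<Longrightarrow> x \<notin> G \<Longrightarrow> u x \<le> 0" "\<And>x. x \<in> K \<Longrightarrow> x \<in> G \<Longrightarrow> c \<le> w x"
    and c: "c > 0"
  shows "(\<integral>x. u x \<partial>riesz_measure) \<le> L w"
proof -
  interpret finite_measure riesz_measure by (rule finite_riesz_measure)
  have KG: "K \<inter> G \<in> sets riesz_measure"
    using G by (auto simp: sets_riesz_measure sets_restrict_space)
  have "(\<integral>x. u x \<partial>riesz_measure) \<le> (\<integral>x. c * indicator (K \<inter> G) x \<partial>riesz_measure)"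
  proof (rule integral_mono[OF integrable_riesz_measure[OF u(1)]])
    show "integrable riesz_measure (\<lambda>x. c * indicator (K \<inter> G) x)"
      using KG by (simp add: emeasure_finite less_top[symmetric])
    show "u x \<le> c * indicator (K \<inter> G) x" if "x \<in> space riesz_measure" for x
      using that u(2) G(2) unfolding space_riesz_measure by (auto simp: indicator_def)
  qed
  also have "\<dots> = c * measure riesz_measure (K \<inter> G)" using KG by simp
  also have "measure riesz_measure (K \<inter> G) = content G"
    using emeasure_riesz_measure[OF KG] mu_open[OF G(1)] content_nonneg[of G] by (simp add: measure_def)
  also have "c * content G \<le> L w"
  proof -
    have "content G \<le> L w / c"
    proof (rule content_least)
      fix g assume g: "g \<in> sub_indicators G"
      then have cg: "continuous_on K g" by (simp add: sub_indicators_def)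
      have "L (\<lambda>x. c * g x) \<le> L w"
      proof (rule L_mono)
        fix x assume x: "x \<in> K"
        show "c * g x \<le> w x"
        proof (cases "x \<in> G")
          case True
          then have "c * g x \<le> c * 1" using g x c by (intro mult_left_mono) (auto simp: sub_indicators_def)
          then show ?thesis using G(3)[OF x True] by simp
        next
          case False
          then show ?thesis using g x w(2) by (simp add: sub_indicators_def)
        qed
      qed (use cg w in \<open>auto intro!: continuous_intros\<close>)
      then show "L g \<le> L w / c" using c by (simp add: L_scale[OF cg] field_simps)
    qed
    then show ?thesis using c by (simp add: field_simps)
  qed
  finally show ?thesis .
qed

text \<open>Slicing \<open>f\<close> into the differences of \<open>min f (k/n)\<close>: slice \<open>k+1\<close> lives on \<open>{f > (k+1)/n}\<close>,
  where slice \<open>k\<close> is full, so its integral is at most \<open>L\<close> of slice \<open>k\<close>.\<close>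

lemma integral_riesz_unit_le:
  assumes f: "continuous_on K f" "\<And>x. x \<in> K \<Longrightarrow> 0 \<le> f x" "\<And>x. x \<in> K \<Longrightarrow> f x \<le> 1"
  shows "(\<integral>x. f x \<partial>riesz_measure) \<le> L f"
proof -
  interpret finite_measure riesz_measure by (rule finite_riesz_measure)
  have L1: "0 \<le> L (\<lambda>_. 1)" by (intro L_nonneg) auto
  have step: "(\<integral>x. f x \<partial>riesz_measure) \<le> L f + L (\<lambda>_. 1) / Suc m" for m
  proof -
    define n :: real where "n = Suc m"
    have n: "n > 0" by (simp add: n_def)
    define s where "s k x = min (f x) (Suc k / n) - min (f x) (k / n)" for k :: nat and x
    have kn: "real k / n \<le> Suc k / n" for k using n by (simp add: divide_right_mono)
    have cs: "continuous_on K (s k)" for k unfolding s_def using f(1) by (intro continuous_intros)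
    have s0: "0 \<le> s k x" for k x using kn[of k] by (auto simp: s_def)
    have s1: "s k x \<le> 1 / n" for k x
    proof -
      have "Suc k / n = k / n + 1 / n" by (simp add: add_divide_distrib)
      moreover have "1 / n > 0" using n by simp
      ultimately show ?thesis unfolding s_def by linarith
    qed
    have fs: "f x = (\<Sum>k<Suc m. s k x)" if "x \<in> K" for x
    proof -
      have "(\<Sum>k<Suc m. s k x) = min (f x) (Suc m / n) - min (f x) (0 / n)"
        unfolding s_def using sum_lessThan_telescope[of "\<lambda>k. min (f x) (real k / n)" "Suc m"] by simp
      also have "Suc m / n = 1" using n unfolding n_def by simp
      finally show ?thesis using f(2,3)[OF that] by simp
    qed
    \<comment> \<open>The bottom slice has no slice beneath it and is bounded by its height 1/n
      times the total mass. This is the only error, and it vanishes as n grows.\<close>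
    have int0: "(\<integral>x. s 0 x \<partial>riesz_measure) \<le> L (\<lambda>_. 1) / n"
    proof -
      have "(\<integral>x. s 0 x \<partial>riesz_measure) \<le> (\<integral>x. 1 / n \<partial>riesz_measure)"
        by (intro integral_mono integrable_riesz_measure cs s1) simp
      then show ?thesis by (simp add: space_riesz_measure measure_riesz_measure)
    qed
    have intS: "(\<integral>x. s (Suc k) x \<partial>riesz_measure) \<le> L (s k)" for k
    proof -
      obtain G where G: "open G" "G \<inter> K = f -` {Suc k / n <..} \<inter> K"
        using continuous_on_open_invariant[THEN iffD1, rule_format, OF f(1) open_greaterThan] by auto
      show ?thesis
      proof (rule integral_riesz_le[OF cs s1 cs s0 G(1)])
        fix x assume x: "x \<in> K"
        { assume "x \<notin> G"
          then have "f x \<le> Suc k / n" using G(2) x by force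
          then show "s (Suc k) x \<le> 0" using kn[of "Suc k"] by (simp add: s_def) }
        { assume "x \<in> G"
          then have "Suc k / n < f x" using G(2) x by force
          then have "s k x = Suc k / n - k / n" using kn[of k] by (simp add: s_def)
          then show "1 / n \<le> s k x" by (simp add: diff_divide_distrib[symmetric]) }
      qed (use n in simp)
    qed
    have "(\<integral>x. f x \<partial>riesz_measure) = (\<integral>x. (\<Sum>k<Suc m. s k x) \<partial>riesz_measure)"
      using fs by (intro Bochner_Integration.integral_cong) (auto simp: space_riesz_measure)
    also have "\<dots> = (\<Sum>k<Suc m. \<integral>x. s k x \<partial>riesz_measure)"
      by (intro Bochner_Integration.integral_sum integrable_riesz_measure cs)
    also have "\<dots> \<le> L (\<lambda>_. 1) / n + (\<Sum>k<m. L (s k))"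
      unfolding sum.lessThan_Suc_shift using int0 intS by (intro add_mono sum_mono) auto
    also have "\<dots> \<le> L (\<lambda>_. 1) / n + (\<Sum>k<Suc m. L (s k))"
      using L_nonneg[OF cs s0, of m] by simp
    also have "(\<Sum>k<Suc m. L (s k)) = L (\<lambda>x. \<Sum>k<Suc m. s k x)"
      using cs by (simp only: L_sum finite_lessThan)
    also have "\<dots> \<le> L f"
      using fs f(1) cs by (intro L_mono) (auto intro!: continuous_intros)
    finally show ?thesis by (simp add: n_def)
  qed
  have "(\<lambda>m. L f + L (\<lambda>_. 1) / Suc m) \<longlonglongrightarrow> L f + 0"
    by (intro tendsto_add tendsto_const LIMSEQ_Suc lim_const_over_n)
  then show ?thesis using step by (intro LIMSEQ_le_const[where X = "\<lambda>m. L f + L (\<lambda>_. 1) / Suc m"]) auto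
qed

text \<open>The one-sided bound, applied to g and to 1 - g, gives equality because the total masses
  agree. An affine change of scale brings a general f into the range [0, 1].\<close>

theorem integral_riesz_measure:
  assumes f: "continuous_on K f"
  shows "(\<integral>x. f x \<partial>riesz_measure) = L f"
proof -
  interpret finite_measure riesz_measure by (rule finite_riesz_measure)
  have unit: "(\<integral>x. g x \<partial>riesz_measure) = L g"
    if g: "continuous_on K g" "\<And>x. x \<in> K \<Longrightarrow> 0 \<le> g x" "\<And>x. x \<in> K \<Longrightarrow> g x \<le> 1" for g
  proof (rule antisym)
    show "(\<integral>x. g x \<partial>riesz_measure) \<le> L g" by (rule integral_riesz_unit_le[OF g])
    have "(\<integral>x. 1 - g x \<partial>riesz_measure) \<le> L (\<lambda>x. 1 - g x)"
      using g by (intro integral_riesz_unit_le continuous_intros) auto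
    moreover have "L (\<lambda>x. 1 - g x) = L (\<lambda>_. 1) - L g"
      using L_linear[of "\<lambda>_. 1" g 1 "-1"] g(1) by simp
    moreover have "(\<integral>x. 1 - g x \<partial>riesz_measure) = L (\<lambda>_. 1) - (\<integral>x. g x \<partial>riesz_measure)"
      using integrable_riesz_measure[OF g(1)]
      by (simp add: space_riesz_measure measure_riesz_measure)
    ultimately show "L g \<le> (\<integral>x. g x \<partial>riesz_measure)" by simp
  qed
  have "bounded (f ` K)" using compact_continuous_image[OF f compact_K] compact_imp_bounded by blast
  then obtain B where B: "B > 0" "\<And>x. x \<in> K \<Longrightarrow> \<bar>f x\<bar> \<le> B" by (auto simp: bounded_pos)
  define g where "g x = (f x + B) / (2 * B)" for x
  have cg: "continuous_on K g" unfolding g_def using f B(1) by (intro continuous_intros) auto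
  have g: "0 \<le> g x" "g x \<le> 1" if "x \<in> K" for x
    using B(1) B(2)[OF that] by (auto simp: g_def field_simps abs_le_iff)
  have fg: "f = (\<lambda>x. (2 * B) * g x + (- B) * 1)"
    using B(1) by (auto simp: g_def field_simps)
  have "(\<integral>x. f x \<partial>riesz_measure) = 2 * B * (\<integral>x. g x \<partial>riesz_measure) - B * L (\<lambda>_. 1)"
    by (subst fg) (use integrable_riesz_measure[OF cg] in
        \<open>simp add: space_riesz_measure measure_riesz_measure\<close>)
  also have "\<dots> = L f"
  proof -
    have "L f = 2 * B * L g + (- B) * L (\<lambda>_. 1)"
      by (subst fg) (rule L_linear[OF cg continuous_on_const])
    then show ?thesis using unit[OF cg g] by simp
  qed
  finally show ?thesis .
qed

end

section \<open>Lipschitz functions and the McShane extension\<close>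

lemma Lip0_iff: "f \<in> Lip0 z \<longleftrightarrow> f z = 0 \<and> (\<exists>C\<ge>0. \<forall>x y. f x - f y \<le> C * dist x y)"
proof -
  have "(\<exists>C. lipschitz_on C UNIV f) \<longleftrightarrow> (\<exists>C\<ge>0. \<forall>x y. f x - f y \<le> C * dist x y)"
  proof
    assume "\<exists>C. lipschitz_on C UNIV f"
    then obtain C where "0 \<le> C" "\<And>x y. dist (f x) (f y) \<le> C * dist x y"
      by (auto simp: lipschitz_on_def)
    then show "\<exists>C\<ge>0. \<forall>x y. f x - f y \<le> C * dist x y"
      by (auto simp: dist_real_def abs_le_iff)
  next
    assume "\<exists>C\<ge>0. \<forall>x y. f x - f y \<le> C * dist x y"
    then obtain C where C: "0 \<le> C" "\<And>x y. f x - f y \<le> C * dist x y" by blast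
    have "dist (f x) (f y) \<le> C * dist x y" for x y
      using C(2)[of x y] C(2)[of y x] by (simp add: dist_real_def dist_commute abs_le_iff)
    then show "\<exists>C. lipschitz_on C UNIV f" using C(1) by (auto simp: lipschitz_on_def)
  qed
  then show ?thesis by (simp add: Lip0_def)
qed

lemma Lip0I: "f z = 0 \<Longrightarrow> 0 \<le> C \<Longrightarrow> (\<And>x y. f x - f y \<le> C * dist x y) \<Longrightarrow> f \<in> Lip0 z"
  unfolding Lip0_iff by blast

lemma Lip0_zero: "f \<in> Lip0 z \<Longrightarrow> f z = 0"
  by (simp add: Lip0_def)

lemma Lip0_combination:
  assumes "f \<in> Lip0 z" "g \<in> Lip0 z"
  shows "(\<lambda>x. a * f x + b * g x) \<in> Lip0 z"
proof -
  obtain C where C: "0 \<le> C" "\<And>x y. \<bar>f x - f y\<bar> \<le> C * dist x y"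
    using assms(1) unfolding Lip0_iff by (metis abs_le_iff dist_commute minus_diff_eq)
  obtain E where E: "0 \<le> E" "\<And>x y. \<bar>g x - g y\<bar> \<le> E * dist x y"
    using assms(2) unfolding Lip0_iff by (metis abs_le_iff dist_commute minus_diff_eq)
  show ?thesis
  proof (rule Lip0I[of _ _ "\<bar>a\<bar> * C + \<bar>b\<bar> * E"])
    fix x y
    have "a * f x + b * g x - (a * f y + b * g y) = a * (f x - f y) + b * (g x - g y)"
      by (simp add: algebra_simps)
    also have "\<dots> \<le> \<bar>a\<bar> * \<bar>f x - f y\<bar> + \<bar>b\<bar> * \<bar>g x - g y\<bar>"
      by (intro add_mono) (metis abs_ge_self abs_mult)+
    also have "\<dots> \<le> \<bar>a\<bar> * (C * dist x y) + \<bar>b\<bar> * (E * dist x y)"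
      using C E by (intro add_mono mult_left_mono) auto
    finally show "a * f x + b * g x - (a * f y + b * g y) \<le> (\<bar>a\<bar> * C + \<bar>b\<bar> * E) * dist x y"
      by (simp add: algebra_simps)
  qed (use C E assms in \<open>auto simp: Lip0_zero\<close>)
qed

lemma Lip0_zero_fun: "(\<lambda>x. 0) \<in> Lip0 z"
  by (rule Lip0I[of _ _ 0]) auto

lemma slope_le_iff:
  "(\<forall>p\<in>Mt. deleeuw f p \<le> c p) \<longleftrightarrow> (\<forall>x y. x \<noteq> y \<longrightarrow> f x - f y \<le> c (x, y) * dist x y)"
  by (auto simp: Mt_def deleeuw_def pos_divide_le_eq)

lemma lipnorm_le:
  assumes "\<And>x y. f x - f y \<le> C * dist x y" "\<exists>a b :: 'a::metric_space. a \<noteq> b"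
  shows "lipnorm (f :: 'a \<Rightarrow> real) \<le> C"
  unfolding lipnorm_def
proof (rule cSUP_least)
  fix p :: "'a \<times> 'a" assume "p \<in> {(x, y). x \<noteq> y}"
  moreover have "\<bar>f x - f y\<bar> \<le> C * dist x y" for x y
    using assms(1)[of x y] assms(1)[of y x] by (simp add: dist_commute abs_le_iff)
  ultimately show "\<bar>f (fst p) - f (snd p)\<bar> / dist (fst p) (snd p) \<le> C"
    by (auto simp: pos_divide_le_eq)
qed (use assms(2) in auto)

lemma lipnorm_ge:
  assumes "f \<in> Lip0 z"
  shows "\<bar>f x - f y\<bar> \<le> lipnorm f * dist x y"
proof (cases "x = y")
  case False
  obtain C where C: "\<And>x y. \<bar>f x - f y\<bar> \<le> C * dist x y"
    using assms unfolding Lip0_iff by (metis abs_le_iff dist_commute minus_diff_eq)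
  have "\<bar>f (fst (x, y)) - f (snd (x, y))\<bar> / dist (fst (x, y)) (snd (x, y)) \<le> lipnorm f"
    unfolding lipnorm_def
  proof (rule cSUP_upper)
    show "bdd_above ((\<lambda>p. \<bar>f (fst p) - f (snd p)\<bar> / dist (fst p) (snd p)) ` {(x, y). x \<noteq> y})"
      by (rule bdd_aboveI2[of _ _ C]) (use C in \<open>auto simp: pos_divide_le_eq\<close>)
  qed (use False in auto)
  then show ?thesis using False by (simp add: pos_divide_le_eq)
qed simp

text \<open>The two distinct points exclude a one-point space, where \<open>lipnorm\<close> is the
  supremum of an empty set of reals and has no specified value.\<close>

lemma lipnorm_nonneg:
  fixes f :: "'a::metric_space \<Rightarrow> real" and a b :: 'a
  assumes "f \<in> Lip0 z" "a \<noteq> b"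
  shows "0 \<le> lipnorm f"
proof -
  have "0 \<le> lipnorm f * dist a b" using lipnorm_ge[OF assms(1), of a b] by linarith
  then show ?thesis using assms(2) by (simp add: zero_le_mult_iff)
qed

section \<open>Weights on pairs and the concave perturbation of the metric\<close>

definition decay :: "'a::metric_space \<times> 'a \<Rightarrow> real" where
  "decay p = 1 / (1 + dist (fst p) (snd p))"

lemma decay_nonneg: "0 \<le> decay p" and decay_le_1: "decay p \<le> 1"
  by (simp_all add: decay_def add_pos_nonneg pos_divide_le_eq)

text \<open>The relative slack of the concave cost: in \<open>concave_increment\<close> a start at
  distance r from \<open>F\<close> gains the factor 1/(1 + r), that is, 1 - far.\<close>

definition far :: "'a::metric_space set \<Rightarrow> 'a \<Rightarrow> real" where
  "far F x = 1 - 1 / (1 + infdist x F)"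

lemma far_nonneg: "0 \<le> far F x" and far_le_1: "far F x \<le> 1"
  using infdist_nonneg[of x F] by (simp_all add: far_def pos_divide_le_eq)

text \<open>The slack of the extension in \<open>symmetric_mcshane_extension\<close>. It averages
  two extensions with slack at one coordinate each, hence the division by 2.\<close>

definition far_decay :: "'a::metric_space set \<Rightarrow> 'a \<times> 'a \<Rightarrow> real" where
  "far_decay F p = decay p * ((far F (fst p) + far F (snd p)) / 2)"

lemma far_decay_nonneg: "0 \<le> far_decay F p" and far_decay_le_1: "far_decay F p \<le> 1"
proof -
  show "0 \<le> far_decay F p"
    unfolding far_decay_def by (intro mult_nonneg_nonneg decay_nonneg) (simp add: far_nonneg)
  have "far_decay F p \<le> 1 * 1"
    unfolding far_decay_def using far_le_1[of F "fst p"] far_le_1[of F "snd p"]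
    by (intro mult_mono decay_le_1) (simp_all add: far_nonneg)
  then show "far_decay F p \<le> 1" by simp
qed

text \<open>For phi(t) = t/(1 + t) monotonicity replaces b by a + t, and phi(a + t) - phi(a) = t/((1
  + a + t)(1 + a)). With r = 0 the bound expresses subadditivity of phi; a start a \<ge> r gains the
  factor 1/(1 + r).\<close>

lemma concave_increment:
  fixes r a b t l :: real
  assumes "0 \<le> r" "r \<le> a" "0 \<le> b" "b \<le> a + t" "0 \<le> t" "0 \<le> l"
  shows "(b + l * (b / (1 + b))) - (a + l * (a / (1 + a))) \<le> t + l * (t / ((1 + t) * (1 + r)))"
proof -
  have "b / (1 + b) \<le> (a + t) / (1 + (a + t))"
    using assms by (simp add: frac_le_eq divide_le_0_iff algebra_simps)
  moreover have "(a + t) / (1 + (a + t)) - a / (1 + a) = t / ((1 + a + t) * (1 + a))"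
    using assms by (simp add: divide_simps) (simp add: algebra_simps)
  moreover have "t / ((1 + a + t) * (1 + a)) \<le> t / ((1 + t) * (1 + r))"
    using assms by (intro divide_left_mono mult_mono mult_pos_pos) auto
  ultimately have "b / (1 + b) - a / (1 + a) \<le> t / ((1 + t) * (1 + r))" by linarith
  then have "l * (b / (1 + b) - a / (1 + a)) \<le> l * (t / ((1 + t) * (1 + r)))"
    using assms(6) by (rule mult_left_mono)
  then show ?thesis using assms(4) by (simp add: algebra_simps)
qed

text \<open>McShane's extension for the metric \<open>d + l d/(1 + d)\<close>. Strict concavity of \<open>t/(1 + t)\<close> makes
  increments from a point away from \<open>F\<close> strictly smaller than the Lipschitz bound; averaging with the
  dual (maximal) extension below yields this gain at both endpoints.\<close>

lemma mcshane_extension: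
  fixes f :: "'a::metric_space \<Rightarrow> real"
  assumes F: "finite F" "F \<noteq> {}" and l: "0 \<le> l"
    and f: "\<And>x y. f x - f y \<le> (1 + l * decay (x, y)) * dist x y"
  obtains g where "\<And>x. x \<in> F \<Longrightarrow> g x = f x"
    "\<And>x y. g y - g x \<le> (1 + l * (decay (x, y) * (1 - far F x))) * dist x y"
proof -
  let ?D = "\<lambda>x y. dist x y + l * (dist x y / (1 + dist x y))"
  have f: "f x - f y \<le> ?D x y" for x y
    using f[of x y] by (simp add: decay_def algebra_simps)
  define g where "g x = Min ((\<lambda>y. f y + ?D x y) ` F)" for x
  have g_le: "g x \<le> f y + ?D x y" if "y \<in> F" for x y
    unfolding g_def using F that by (intro Min_le) auto
  have g_eq: "\<exists>y\<in>F. g x = f y + ?D x y" for x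
  proof -
    have "g x \<in> (\<lambda>y. f y + ?D x y) ` F" unfolding g_def using F by (intro Min_in) auto
    then show ?thesis by auto
  qed
  show thesis
  proof
    fix x assume x: "x \<in> F"
    obtain y where y: "y \<in> F" "g x = f y + ?D x y" using g_eq by blast
    show "g x = f x" using g_le[OF x, of x] f[of x y] y by simp
  next
    fix x x'
    obtain y where y: "y \<in> F" "g x = f y + ?D x y" using g_eq by blast
    \<comment> \<open>The minimiser for \<open>x\<close> is reused for \<open>x'\<close>, so the
      gain depends on the distance from \<open>x\<close> to \<open>F\<close> and is
      one-sided.\<close>
    have "g x' - g x \<le> ?D x' y - ?D x y" using g_le[OF y(1), of x'] y(2) by linarith
    also have "\<dots> \<le> dist x x' + l * (dist x x' / ((1 + dist x x') * (1 + infdist x F)))"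
      using infdist_le[OF y(1), of x] dist_triangle[of x' y x] l
      by (intro concave_increment) (auto simp: infdist_nonneg dist_commute)
    also have "\<dots> = (1 + l * (decay (x, x') * (1 - far F x))) * dist x x'"
      by (simp add: decay_def far_def algebra_simps)
    finally show "g x' - g x \<le> (1 + l * (decay (x, x') * (1 - far F x))) * dist x x'" .
  qed
qed

text \<open>In the bound for a difference of values at x and y, \<open>g\<close> has its slack at y,
  while \<open>- k\<close>, from the same formula for \<open>- f\<close>, has it at x. The average
  keeps half of each.\<close>

lemma symmetric_mcshane_extension:
  fixes f :: "'a::metric_space \<Rightarrow> real"
  assumes F: "finite F" "F \<noteq> {}" and l: "0 \<le> l"
    and f: "\<And>x y. f x - f y \<le> (1 + l * decay (x, y)) * dist x y"
  obtains h where "\<And>x. x \<in> F \<Longrightarrow> h x = f x"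
    "\<And>x y. h x - h y \<le> (1 + l * (decay (x, y) - far_decay F (x, y))) * dist x y"
proof -
  have sym: "decay (x, y) = decay (y, x)" for x y :: 'a by (simp add: decay_def dist_commute)
  obtain g where g: "\<And>x. x \<in> F \<Longrightarrow> g x = f x"
    "\<And>x y. g y - g x \<le> (1 + l * (decay (x, y) * (1 - far F x))) * dist x y"
    using mcshane_extension[OF assms] by blast
  have f': "- f x - - f y \<le> (1 + l * decay (x, y)) * dist x y" for x y
    using f[of y x] by (simp add: sym[of x y] dist_commute)
  obtain k where k: "\<And>x. x \<in> F \<Longrightarrow> k x = - f x"
    "\<And>x y. k y - k x \<le> (1 + l * (decay (x, y) * (1 - far F x))) * dist x y"
    using mcshane_extension[OF F l, of "\<lambda>x. - f x", OF f'] by blast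
  show thesis
  proof (rule that[of "\<lambda>x. (g x - k x) / 2"])
    fix x y
    have "g x - g y \<le> (1 + l * (decay (x, y) * (1 - far F y))) * dist x y"
      using g(2)[of x y] by (simp add: sym[of x y] dist_commute)
    with k(2)[of y x]
    have "((k y - k x) + (g x - g y)) / 2 \<le> ((1 + l * (decay (x, y) * (1 - far F x))) * dist x y
        + (1 + l * (decay (x, y) * (1 - far F y))) * dist x y) / 2"
      by (intro divide_right_mono add_mono) auto
    moreover have "(g x - k x) / 2 - (g y - k y) / 2 = ((k y - k x) + (g x - g y)) / 2"
      by (simp add: field_simps)
    ultimately have "(g x - k x) / 2 - (g y - k y) / 2
        \<le> ((1 + l * (decay (x, y) * (1 - far F x))) * dist x y
        + (1 + l * (decay (x, y) * (1 - far F y))) * dist x y) / 2"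
      by simp
    also have "\<dots> = (1 + l * (decay (x, y) - far_decay F (x, y))) * dist x y"
      by (simp add: far_decay_def field_simps)
    finally show "(g x - k x) / 2 - (g y - k y) / 2
        \<le> (1 + l * (decay (x, y) - far_decay F (x, y))) * dist x y" .
  qed (use g k in simp)
qed

section \<open>Optimal functionals\<close>

locale lip_functional =
  fixes z :: "'a::metric_space" and m :: "('a \<Rightarrow> real) \<Rightarrow> real"
  assumes two_points: "\<exists>a b :: 'a. a \<noteq> b"
    and dual: "lip0_dual z m"
begin

lemma m_linear: "f \<in> Lip0 z \<Longrightarrow> g \<in> Lip0 z \<Longrightarrow> m (\<lambda>x. a * f x + b * g x) = a * m f + b * m g"
  using dual by (simp add: lip0_dual_def)

lemma m_scale: "f \<in> Lip0 z \<Longrightarrow> m (\<lambda>x. a * f x) = a * m f"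
  using m_linear[of f f a 0] by simp

lemma m_zero: "m (\<lambda>x. 0) = 0"
  using m_scale[OF Lip0_zero_fun, of 0] by simp

lemma bdd_dnorm: "bdd_above ((\<lambda>f. \<bar>m f\<bar>) ` {f \<in> Lip0 z. lipnorm f \<le> 1})"
proof -
  obtain C where C: "\<And>f. f \<in> Lip0 z \<Longrightarrow> \<bar>m f\<bar> \<le> C * lipnorm f"
    using dual unfolding lip0_dual_def by blast
  obtain a b :: 'a where "a \<noteq> b" using two_points by blast
  have "\<bar>m f\<bar> \<le> \<bar>C\<bar> * 1" if "f \<in> Lip0 z" "lipnorm f \<le> 1" for f
    using C[OF that(1)] lipnorm_nonneg[OF that(1) \<open>a \<noteq> b\<close>] that(2)
    by (meson abs_ge_self abs_ge_zero mult_mono order_trans)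
  then show ?thesis by (intro bdd_aboveI2[of _ _ "\<bar>C\<bar> * 1"]) auto
qed

lemma m_le_dnorm:
  assumes f: "f \<in> Lip0 z" "\<And>x y. f x - f y \<le> C * dist x y" and C: "0 \<le> C"
  shows "m f \<le> C * dnorm z m"
proof (cases "C = 0")
  case True
  have "f x = 0" for x using f(2)[of x z] f(2)[of z x] True Lip0_zero[OF f(1)] by simp
  then have "f = (\<lambda>x. 0)" by auto
  then show ?thesis using True m_zero by simp
next
  case False
  then have C: "C > 0" using C by simp
  let ?g = "\<lambda>x. (1 / C) * f x"
  have "?g x - ?g y \<le> 1 * dist x y" for x y
    using f(2)[of x y] C by (simp add: diff_divide_distrib[symmetric] pos_divide_le_eq mult.commute)
  then have "lipnorm ?g \<le> 1" by (rule lipnorm_le[OF _ two_points])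
  moreover have "?g \<in> Lip0 z" using Lip0_combination[OF f(1) f(1), of "1 / C" 0] by simp
  ultimately have "\<bar>m ?g\<bar> \<le> dnorm z m"
    unfolding dnorm_def by (intro cSUP_upper[OF _ bdd_dnorm]) auto
  then show ?thesis using m_scale[OF f(1), of "1 / C"] C
    by (simp add: pos_divide_le_eq mult.commute)
qed

lemma dnorm_nonneg: "0 \<le> dnorm z m"
  using m_le_dnorm[OF Lip0_zero_fun, of 1] m_zero by simp

lemma nearly_norming:
  assumes "\<delta> > 0"
  obtains f where "f \<in> Lip0 z" "\<And>x y. f x - f y \<le> dist x y" "m f > dnorm z m - \<delta>"
proof -
  have "dnorm z m - \<delta> < dnorm z m" using assms by simp
  moreover have "lipnorm (\<lambda>x::'a. 0) \<le> 1" by (rule lipnorm_le[OF _ two_points]) simp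
  ultimately obtain g where g: "g \<in> Lip0 z" "lipnorm g \<le> 1" "dnorm z m - \<delta> < \<bar>m g\<bar>"
    using less_cSUP_iff[OF _ bdd_dnorm] Lip0_zero_fun unfolding dnorm_def by blast
  have g1: "\<bar>g x - g y\<bar> \<le> dist x y" for x y
  proof -
    have "lipnorm g * dist x y \<le> 1 * dist x y" using g(2) by (intro mult_right_mono) auto
    then show ?thesis using lipnorm_ge[OF g(1), of x y] by simp
  qed
  show thesis
  proof (cases "0 \<le> m g")
    case True
    have "g x - g y \<le> dist x y" for x y using g1[of x y] by linarith
    then show ?thesis using that[of g] g True by simp
  next
    case False
    have "- g x - - g y \<le> dist x y" for x y using g1[of x y] by linarith
    moreover have "(\<lambda>x. - g x) \<in> Lip0 z" using Lip0_combination[OF g(1) g(1), of "-1" 0] by simp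
    ultimately show ?thesis using that[of "\<lambda>x. - g x"] g False m_scale[OF g(1), of "-1"] by simp
  qed
qed

text \<open>Beyond boundedness of m, membership in the free space enters the proof only in this
  form. It permits changing a function away from a finite set at little cost in m; the base point is
  put into \<open>S\<close> so that the change respects the value 0 there.\<close>

lemma free_space_almost_finite:
  assumes m: "m \<in> free_space z" and e: "\<epsilon> > 0"
  obtains S where "finite S" "z \<in> S"
    "\<forall>f\<in>Lip0 z. \<forall>g\<in>Lip0 z. \<forall>C\<ge>0. (\<forall>x y. f x - f y \<le> C * dist x y) \<longrightarrow>
       (\<forall>x y. g x - g y \<le> C * dist x y) \<longrightarrow> (\<forall>x\<in>S. f x = g x) \<longrightarrow> m f \<le> m g + \<epsilon> * C"
proof -
  have "\<epsilon> / 2 > 0" using e by simp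
  then obtain S a where S: "finite S" and n: "dnorm z (\<lambda>f. m f - (\<Sum>x\<in>S. a x * f x)) < \<epsilon> / 2"
    using m unfolding free_space_def by blast
  let ?n = "\<lambda>f. m f - (\<Sum>x\<in>S. a x * f x)"
  obtain c where c: "\<And>f. f \<in> Lip0 z \<Longrightarrow> \<bar>m f\<bar> \<le> c * lipnorm f"
    using dual unfolding lip0_dual_def by blast
  \<comment> \<open>A small \<open>dnorm\<close> says something about the remainder only if its
    supremum is over a bounded set, so the remainder is first shown to be a bounded
    functional.\<close>
  have dual_n: "lip0_dual z ?n"
    unfolding lip0_dual_def
  proof (intro conjI ballI allI exI)
    fix f g :: "'a \<Rightarrow> real" and b b' :: real
    assume "f \<in> Lip0 z" "g \<in> Lip0 z"
    then show "?n (\<lambda>x. b * f x + b' * g x) = b * ?n f + b' * ?n g"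
      by (simp add: m_linear algebra_simps sum.distrib sum_distrib_left)
  next
    fix f :: "'a \<Rightarrow> real" assume f: "f \<in> Lip0 z"
    have "\<bar>f x\<bar> \<le> lipnorm f * dist x z" for x
      using lipnorm_ge[OF f, of x z] Lip0_zero[OF f] by simp
    then have "\<bar>\<Sum>x\<in>S. a x * f x\<bar> \<le> (\<Sum>x\<in>S. \<bar>a x\<bar> * (lipnorm f * dist x z))"
      by (intro order_trans[OF sum_abs] sum_mono) (auto simp: abs_mult intro: mult_left_mono)
    then have "\<bar>?n f\<bar> \<le> c * lipnorm f + (\<Sum>x\<in>S. \<bar>a x\<bar> * (lipnorm f * dist x z))"
      using c[OF f] by linarith
    then show "\<bar>?n f\<bar> \<le> (c + (\<Sum>x\<in>S. \<bar>a x\<bar> * dist x z)) * lipnorm f"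
      by (simp add: algebra_simps sum_distrib_left)
  qed
  interpret n: lip_functional z ?n
    by unfold_locales (use two_points dual_n in auto)
  have bound: "?n f \<le> \<epsilon> / 2 * C"
    if "f \<in> Lip0 z" "0 \<le> C" "\<And>x y. f x - f y \<le> C * dist x y" for f C
  proof -
    have "?n f \<le> C * dnorm z ?n" using n.m_le_dnorm[OF that(1,3,2)] .
    also have "\<dots> \<le> C * (\<epsilon> / 2)" using n that(2) by (intro mult_left_mono) auto
    finally show ?thesis by (simp add: mult.commute)
  qed
  show thesis
  proof (rule that[of "insert z S"], goal_cases)
    case 3
    show ?case
    proof (intro ballI allI impI)
      fix f g and C :: real
      assume f: "f \<in> Lip0 z" and f': "\<forall>x y. f x - f y \<le> C * dist x y"
        and g: "g \<in> Lip0 z" and g': "\<forall>x y. g x - g y \<le> C * dist x y"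
        and C: "0 \<le> C" and eq: "\<forall>x\<in>insert z S. f x = g x"
      have neg: "- g x - - g y \<le> C * dist x y" for x y
        using g'[rule_format, of y x] by (simp add: dist_commute)
      have "(\<lambda>x. - g x) \<in> Lip0 z" using Lip0_combination[OF g g, of "-1" 0] by simp
      from bound[OF this C neg] have "- ?n g \<le> \<epsilon> / 2 * C"
        using m_scale[OF g, of "-1"] by (simp add: sum_negf)
      moreover have "?n f \<le> \<epsilon> / 2 * C" using f f' C by (intro bound) auto
      moreover have "(\<Sum>x\<in>S. a x * f x) = (\<Sum>x\<in>S. a x * g x)" using eq by simp
      ultimately show "m f \<le> m g + \<epsilon> * C" by simp
    qed
  qed (use S in auto)
qed

text \<open>If \<open>N l\<close> denotes the norm of \<open>m\<close> for the metric \<open>d + l d/(1 + d)\<close>, then \<open>rate\<close> is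
  \<open>SUP l>0. (N l - N 0) / l\<close>. It will be the least value of \<open>\<integral> decay d\<mu>\<close> over all optimal
  representations \<open>\<mu>\<close>.\<close>

definition steep :: "real \<Rightarrow> ('a \<Rightarrow> real) set" where
  "steep l = {f \<in> Lip0 z. \<forall>p\<in>Mt. deleeuw f p \<le> 1 + l * decay p}"

definition rate :: real where
  "rate = (SUP (l, f)\<in>{(l, f). l > 0 \<and> f \<in> steep l}. (m f - dnorm z m) / l)"

lemma steepD:
  assumes "f \<in> steep l"
  shows "f \<in> Lip0 z" "f x - f y \<le> (1 + l * decay (x, y)) * dist x y"
  using assms unfolding steep_def slope_le_iff by (cases "x = y"; auto)+

lemma steep_lipschitz:
  assumes "f \<in> steep l" "0 \<le> l"
  shows "f x - f y \<le> (1 + l) * dist x y"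
proof -
  have "(1 + l * decay (x, y)) * dist x y \<le> (1 + l * 1) * dist x y"
    using assms(2) by (intro mult_right_mono add_left_mono mult_left_mono decay_le_1) auto
  then show ?thesis using steepD(2)[OF assms(1), of x y] by simp
qed

lemma bdd_rate: "bdd_above ((\<lambda>(l, f). (m f - dnorm z m) / l) ` {(l, f). l > 0 \<and> f \<in> steep l})"
proof (rule bdd_aboveI2, clarify)
  fix l :: real and f assume l: "l > 0" and f: "f \<in> steep l"
  have "m f \<le> (1 + l) * dnorm z m"
    using steepD(1)[OF f] steep_lipschitz[OF f] l by (intro m_le_dnorm) auto
  then show "(m f - dnorm z m) / l \<le> dnorm z m" using l by (simp add: field_simps)
qed

lemma m_le_rate:
  assumes "l \<ge> 0" "f \<in> steep l"
  shows "m f \<le> dnorm z m + l * rate"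
proof (cases "l = 0")
  case True
  then show ?thesis
    using m_le_dnorm[OF steepD(1)[OF assms(2)], of 1] steep_lipschitz[OF assms(2)] by simp
next
  case False
  then have l: "l > 0" using assms by simp
  have "(case (l, f) of (l, f) \<Rightarrow> (m f - dnorm z m) / l) \<le> rate"
    unfolding rate_def using l assms(2) by (intro cSUP_upper[OF _ bdd_rate]) auto
  then show ?thesis using l by (simp add: field_simps)
qed

lemma rate_nearly_attained:
  assumes "\<delta> > 0"
  obtains l f where "l > 0" "f \<in> steep l" "m f > dnorm z m + l * (rate - \<delta>)"
proof -
  have "(\<lambda>_. 0) \<in> steep 1"
    using Lip0_zero_fun by (auto simp: steep_def deleeuw_def decay_nonneg intro!: add_nonneg_nonneg)
  then have "{(l, f). l > 0 \<and> f \<in> steep l} \<noteq> {}" by force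
  moreover have "rate - \<delta> < rate" using assms by simp
  ultimately obtain l f where l: "l > 0" "f \<in> steep l" "rate - \<delta> < (m f - dnorm z m) / l"
    using less_cSUP_iff[OF _ bdd_rate] unfolding rate_def by auto
  then have "m f > dnorm z m + l * (rate - \<delta>)" by (simp add: field_simps)
  then show thesis using that l by blast
qed

text \<open>This is the consistency of the demands that will be put on \<open>L\<close>. Division by
  the constant term reduces it to \<open>m_le_rate\<close>; since a may be 0, the division is by
  some c > a, and c then tends to a.\<close>

lemma m_le_majorant:
  assumes a: "0 \<le> a" and b: "0 \<le> b" and f: "f \<in> Lip0 z"
    and le: "\<And>p. p \<in> Mt \<Longrightarrow> deleeuw f p \<le> a + b * decay p"
  shows "m f \<le> a * dnorm z m + b * rate"
proof -
  have pos: "m f \<le> c * dnorm z m + b * rate" if c: "c > a" for c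
  proof -
    have c0: "c > 0" using c a by simp
    have "(\<lambda>x. (1 / c) * f x) \<in> steep (b / c)"
      unfolding steep_def
    proof (intro CollectI conjI ballI)
      show "(\<lambda>x. (1 / c) * f x) \<in> Lip0 z" using Lip0_combination[OF f f, of "1 / c" 0] by simp
      fix p :: "'a \<times> 'a" assume "p \<in> Mt"
      then have "deleeuw f p \<le> c + b * decay p" using le[of p] c by simp
      then have "deleeuw f p / c \<le> (c + b * decay p) / c" using c0 by (simp add: divide_right_mono)
      then show "deleeuw (\<lambda>x. (1 / c) * f x) p \<le> 1 + b / c * decay p"
        using c0 by (simp add: deleeuw_def split_beta add_divide_distrib diff_divide_distrib mult.commute)
    qed
    from m_le_rate[OF _ this] show ?thesis
      using c0 b m_scale[OF f, of "1 / c"] by (simp add: field_simps)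
  qed
  show ?thesis
  proof (rule field_le_epsilon)
    fix e :: real assume e: "e > 0"
    have "m f \<le> (a + e / (1 + dnorm z m)) * dnorm z m + b * rate"
      using e dnorm_nonneg by (intro pos) simp
    also have "\<dots> \<le> a * dnorm z m + e + b * rate"
      using e dnorm_nonneg by (simp add: field_simps)
    finally show "m f \<le> a * dnorm z m + b * rate + e" by simp
  qed
qed

end

text \<open>The value at \<open>decay\<close> is what makes \<open>L\<close> tight: an optimal \<open>L\<close> need not be concentrated on
  \<open>M \<times> M\<close>.\<close>

locale optimal_functional = lip_functional z m
  for z :: "'a::metric_space" and m +
  fixes L :: "('a \<times> 'a \<Rightarrow> real) \<Rightarrow> real"
  assumes L_linear: "bounded (u ` Mt) \<Longrightarrow> bounded (v ` Mt) \<Longrightarrow>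
        L (\<lambda>p. a * u p + b * v p) = a * L u + b * L v"
    and L_nonneg: "bounded (u ` Mt) \<Longrightarrow> (\<And>p. p \<in> Mt \<Longrightarrow> 0 \<le> u p) \<Longrightarrow> 0 \<le> L u"
    and L_deleeuw: "f \<in> Lip0 z \<Longrightarrow> L (deleeuw f) = m f"
    and L_one: "L (\<lambda>_. 1) = dnorm z m"
    and L_decay: "L decay \<le> rate"

lemma bounded_image_real:
  "(\<And>p. p \<in> A \<Longrightarrow> \<bar>u p\<bar> \<le> (B::real)) \<Longrightarrow> bounded (u ` A)"
  by (auto simp: bounded_iff)

lemma bounded_deleeuw:
  assumes "f \<in> Lip0 z"
  shows "bounded (deleeuw f ` Mt)"
proof (rule bounded_image_real)
  fix p :: "'a \<times> 'a" assume "p \<in> Mt"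
  then show "\<bar>deleeuw f p\<bar> \<le> lipnorm f"
    using lipnorm_ge[OF assms, of "fst p" "snd p"]
    by (auto simp: deleeuw_def split_beta Mt_def pos_divide_le_eq)
qed

lemma bounded_decay: "bounded (decay ` A)"
  by (intro bounded_image_real[of _ _ 1]) (simp add: decay_nonneg decay_le_1)

lemma bounded_far_decay: "bounded (far_decay F ` A)"
  by (intro bounded_image_real[of _ _ 1]) (simp add: far_decay_nonneg far_decay_le_1)

lemma bounded_combination:
  fixes u v :: "'b \<Rightarrow> real"
  assumes "bounded (u ` A)" "bounded (v ` A)"
  shows "bounded ((\<lambda>p. a * u p + b * v p) ` A)"
proof -
  obtain B where B: "\<And>p. p \<in> A \<Longrightarrow> \<bar>u p\<bar> \<le> B" using assms(1) by (auto simp: bounded_iff)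
  obtain E where E: "\<And>p. p \<in> A \<Longrightarrow> \<bar>v p\<bar> \<le> E" using assms(2) by (auto simp: bounded_iff)
  have "\<bar>a * u p + b * v p\<bar> \<le> \<bar>a\<bar> * B + \<bar>b\<bar> * E" if "p \<in> A" for p
    using B[OF that] E[OF that]
    by (intro order_trans[OF abs_triangle_ineq] add_mono) (auto simp: abs_mult intro: mult_left_mono)
  then show ?thesis by (rule bounded_image_real)
qed

text \<open>The demands bound L u whenever u lies below some a + b * decay + deleeuw f. They are
  consistent by \<open>m_le_majorant\<close> for - f. Special choices of a, b, f give positivity,
  the representation of m and the upper bounds for L 1 and L decay; the lower bound for L 1 comes
  from nearly norming functions.\<close>

lemma (in lip_functional) optimal_functional_exists:
  obtains L where "optimal_functional z m L"
proof -
  let ?V = "{u :: 'a \<times> 'a \<Rightarrow> real. bounded (u ` Mt)}"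
  define S where "S = {(u, c). u \<in> ?V \<and> (\<exists>a\<ge>0. \<exists>b\<ge>0. \<exists>f\<in>Lip0 z.
      (\<forall>p\<in>Mt. u p \<le> a + b * decay p + deleeuw f p) \<and> c = a * dnorm z m + b * rate + m f)}"
  have SI: "(u, a * dnorm z m + b * rate + m f) \<in> S"
    if "bounded (u ` Mt)" "0 \<le> a" "0 \<le> b" "f \<in> Lip0 z"
      "\<And>p. p \<in> Mt \<Longrightarrow> u p \<le> a + b * decay p + deleeuw f p" for u a b f
    using that unfolding S_def by blast
  have cone: "constraint_cone ?V S"
    unfolding constraint_cone_def
  proof (intro conjI allI impI ballI)
    fix u c assume "(u, c) \<in> S"
    then show "u \<in> ?V" by (simp add: S_def)
  next
    fix u c v e and s t :: real
    assume "(u, c) \<in> S" "(v, e) \<in> S" and st: "0 \<le> s" "0 \<le> t"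
    then obtain a b f a' b' f' where
      1: "bounded (u ` Mt)" "a \<ge> 0" "b \<ge> 0" "f \<in> Lip0 z"
         "\<And>p. p \<in> Mt \<Longrightarrow> u p \<le> a + b * decay p + deleeuw f p" "c = a * dnorm z m + b * rate + m f" and
      2: "bounded (v ` Mt)" "a' \<ge> 0" "b' \<ge> 0" "f' \<in> Lip0 z"
         "\<And>p. p \<in> Mt \<Longrightarrow> v p \<le> a' + b' * decay p + deleeuw f' p" "e = a' * dnorm z m + b' * rate + m f'"
      unfolding S_def by blast
    have "((\<lambda>x. s * u x + t * v x), (s * a + t * a') * dnorm z m + (s * b + t * b') * rate
        + m (\<lambda>x. s * f x + t * f' x)) \<in> S"
    proof (rule SI[OF bounded_combination[OF 1(1) 2(1)] _ _ Lip0_combination[OF 1(4) 2(4)]])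
      fix p :: "'a \<times> 'a" assume p: "p \<in> Mt"
      have "s * u p + t * v p \<le> s * (a + b * decay p + deleeuw f p) + t * (a' + b' * decay p + deleeuw f' p)"
        using 1(5)[OF p] 2(5)[OF p] st by (intro add_mono mult_left_mono)
      also have "\<dots> = s * a + t * a' + (s * b + t * b') * decay p + (s * deleeuw f p + t * deleeuw f' p)"
        by (simp add: algebra_simps)
      also have "s * deleeuw f p + t * deleeuw f' p = deleeuw (\<lambda>x. s * f x + t * f' x) p"
        by (simp add: deleeuw_def split_beta add_divide_distrib[symmetric] algebra_simps)
      finally show "s * u p + t * v p
          \<le> s * a + t * a' + (s * b + t * b') * decay p + deleeuw (\<lambda>x. s * f x + t * f' x) p" .
    qed (use st 1 2 in auto)
    then show "((\<lambda>x. s * u x + t * v x), s * c + t * e) \<in> S"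
      by (simp add: 1(6) 2(6) m_linear[OF 1(4) 2(4)] algebra_simps)
  next
    fix u :: "'a \<times> 'a \<Rightarrow> real" assume u: "u \<in> ?V"
    then have bu: "bounded (u ` Mt)" by simp
    then obtain B where B: "B > 0" "\<And>p. p \<in> Mt \<Longrightarrow> \<bar>u p\<bar> \<le> B" by (auto simp: bounded_pos)
    have "(u, B * dnorm z m + 0 * rate + m (\<lambda>_. 0)) \<in> S"
    proof (rule SI[OF bu _ _ Lip0_zero_fun])
      fix p :: "'a \<times> 'a" assume "p \<in> Mt"
      then show "u p \<le> B + 0 * decay p + deleeuw (\<lambda>_. 0) p"
        using B(2)[of p] by (simp add: deleeuw_def split_beta abs_le_iff)
    qed (use B in auto)
    then show "\<exists>c. (u, c) \<in> S" by blast
  next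
    fix c assume "((\<lambda>_. 0), c) \<in> S"
    then obtain a b f where abf: "a \<ge> 0" "b \<ge> 0" "f \<in> Lip0 z"
      "\<And>p. p \<in> Mt \<Longrightarrow> 0 \<le> a + b * decay p + deleeuw f p" "c = a * dnorm z m + b * rate + m f"
      unfolding S_def by blast
    have neg: "(\<lambda>x. - f x) \<in> Lip0 z" using Lip0_combination[OF abf(3) abf(3), of "-1" 0] by simp
    have "deleeuw (\<lambda>x. - f x) p = - deleeuw f p" for p
      by (simp add: deleeuw_def split_beta minus_divide_left)
    then have "m (\<lambda>x. - f x) \<le> a * dnorm z m + b * rate"
      using abf(4) by (intro m_le_majorant[OF abf(1,2) neg]) (simp add: add.commute, force)
    then show "0 \<le> c" using abf(5) m_scale[OF abf(3), of "-1"] by simp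
  qed
  have V: "(\<lambda>x. a * u x + b * v x) \<in> ?V" if "u \<in> ?V" "v \<in> ?V" for u v a b
    using that bounded_combination by blast
  obtain L where lin: "\<And>u v a b. u \<in> ?V \<Longrightarrow> v \<in> ?V \<Longrightarrow> L (\<lambda>x. a * u x + b * v x) = a * L u + b * L v"
    and le: "\<And>u c. (u, c) \<in> S \<Longrightarrow> L u \<le> c"
    using constraint_cone_functional[OF V cone] by blast
  have nonneg: "0 \<le> L u" if u: "bounded (u ` Mt)" "\<And>p. p \<in> Mt \<Longrightarrow> 0 \<le> u p" for u
  proof -
    have bu: "bounded ((\<lambda>p. -1 * u p + 0 * u p) ` Mt)" by (rule bounded_combination[OF u(1) u(1)])
    have "((\<lambda>p. -1 * u p + 0 * u p), 0 * dnorm z m + 0 * rate + m (\<lambda>_. 0)) \<in> S"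
      by (rule SI[OF bu _ _ Lip0_zero_fun]) (use u(2) in \<open>auto simp: deleeuw_def\<close>)
    from le[OF this] show ?thesis using lin[of u u "-1" 0] u(1) m_zero by simp
  qed
  have del_le: "L (deleeuw f) \<le> m f" if "f \<in> Lip0 z" for f
    using le[OF SI[OF bounded_deleeuw[OF that] _ _ that, of 0 0]] by simp
  have del: "L (deleeuw f) = m f" if f: "f \<in> Lip0 z" for f
  proof (rule antisym[OF del_le[OF f]])
    have "(\<lambda>x. - f x) \<in> Lip0 z" using Lip0_combination[OF f f, of "-1" 0] by simp
    from del_le[OF this] have "L (deleeuw (\<lambda>x. - f x)) \<le> - m f"
      using m_scale[OF f, of "-1"] by simp
    moreover have "deleeuw (\<lambda>x. - f x) = (\<lambda>p. -1 * deleeuw f p + 0 * deleeuw f p)"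
      by (auto simp: deleeuw_def fun_eq_iff minus_divide_left)
    ultimately show "m f \<le> L (deleeuw f)"
      using lin[of "deleeuw f" "deleeuw f" "-1" 0] bounded_deleeuw[OF f] by simp
  qed
  have b1: "bounded ((\<lambda>p::'a \<times> 'a. 1::real) ` Mt)" by (rule bounded_image_real[of _ _ 1]) simp
  have one_le: "L (\<lambda>_. 1) \<le> dnorm z m"
    using le[OF SI[OF b1 _ _ Lip0_zero_fun, of 1 0]] m_zero by (simp add: deleeuw_def split_beta)
  have one_ge: "dnorm z m \<le> L (\<lambda>_. 1)"
  proof (rule field_le_epsilon)
    fix e :: real assume "e > 0"
    then obtain f where f: "f \<in> Lip0 z" "\<And>x y. f x - f y \<le> dist x y" "m f > dnorm z m - e"
      using nearly_norming by blast
    have "\<forall>p\<in>Mt. deleeuw f p \<le> 1" unfolding slope_le_iff using f(2) by simp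
    then have "0 \<le> L (\<lambda>p. 1 * 1 + (-1) * deleeuw f p)"
      by (intro nonneg bounded_combination[OF b1 bounded_deleeuw[OF f(1)]]) auto
    also have "\<dots> = L (\<lambda>_. 1) - m f"
      using lin[of "\<lambda>_. 1" "deleeuw f" 1 "-1"] b1 bounded_deleeuw[OF f(1)] del[OF f(1)] by simp
    finally show "dnorm z m \<le> L (\<lambda>_. 1) + e" using f(3) by simp
  qed
  have decay_le: "L decay \<le> rate"
    using le[OF SI[OF bounded_decay _ _ Lip0_zero_fun, of 0 1]] m_zero
    by (simp add: deleeuw_def split_beta)
  have "optimal_functional z m L"
    by unfold_locales (use lin nonneg del one_le one_ge decay_le in auto)
  then show thesis by (rule that)
qed

section \<open>Tightness of the optimal functional\<close>

context optimal_functional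
begin

lemma L_mono:
  assumes "bounded (u ` Mt)" "bounded (v ` Mt)" "\<And>p. p \<in> Mt \<Longrightarrow> u p \<le> v p"
  shows "L u \<le> L v"
proof -
  have "0 \<le> L (\<lambda>p. 1 * v p + (-1) * u p)"
    using assms by (intro L_nonneg bounded_combination) auto
  then show ?thesis using L_linear[OF assms(2,1), of 1 "-1"] by simp
qed

lemma bounded_one: "bounded ((\<lambda>_. 1 :: real) ` A)"
  by (rule bounded_image_real[of _ _ 1]) simp

text \<open>The re-extended function h has slopes below 1 + l * (decay - far_decay F), yet m h
  almost reaches the norm plus l * rate. Since L decay is at most \<open>rate\<close>, the
  subtracted term can take up very little.\<close>

lemma far_decay_small:
  assumes m: "m \<in> free_space z" and \<delta>: "\<delta> > 0"
  obtains F where "finite F" "F \<noteq> {}" "L (far_decay F) \<le> \<delta>"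
proof -
  have "\<delta> / 2 > 0" using \<delta> by simp
  then obtain l f where l: "l > 0" and f: "f \<in> steep l" and mf: "m f > dnorm z m + l * (rate - \<delta> / 2)"
    using rate_nearly_attained by blast
  \<comment> \<open>Both functions to be compared are (1 + l)-Lipschitz, so this tolerance costs l *
    \<delta> / 2. With the defect l * \<delta> / 2 of f the total is l * \<delta>, and division by l
    leaves \<delta>.\<close>
  have \<delta>l: "l * \<delta> / (2 * (1 + l)) > 0" using l \<delta> by simp
  obtain F where F: "finite F" "z \<in> F"
    and close: "\<forall>f\<in>Lip0 z. \<forall>g\<in>Lip0 z. \<forall>C\<ge>0. (\<forall>x y. f x - f y \<le> C * dist x y) \<longrightarrow>
       (\<forall>x y. g x - g y \<le> C * dist x y) \<longrightarrow> (\<forall>x\<in>F. f x = g x) \<longrightarrow>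
       m f \<le> m g + l * \<delta> / (2 * (1 + l)) * C"
    by (rule free_space_almost_finite[OF m \<delta>l])
  have Fne: "F \<noteq> {}" using F by blast
  obtain h where h: "\<And>x. x \<in> F \<Longrightarrow> h x = f x"
    "\<And>x y. h x - h y \<le> (1 + l * (decay (x, y) - far_decay F (x, y))) * dist x y"
    using symmetric_mcshane_extension[OF F(1) Fne, of l f] l steepD(2)[OF f] by auto
  have h_lip: "h x - h y \<le> (1 + l) * dist x y" for x y
  proof -
    have "decay (x, y) - far_decay F (x, y) \<le> 1"
      using far_decay_nonneg[of F "(x, y)"] decay_le_1[of "(x, y)"] by linarith
    then have "(1 + l * (decay (x, y) - far_decay F (x, y))) * dist x y \<le> (1 + l * 1) * dist x y"
      using l by (intro mult_right_mono add_left_mono mult_left_mono) auto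
    then show ?thesis using h(2)[of x y] by simp
  qed
  have hL: "h \<in> Lip0 z"
    using h(1)[OF F(2)] Lip0_zero[OF steepD(1)[OF f]] h_lip l by (intro Lip0I[of _ _ "1 + l"]) auto
  have "m f \<le> m h + l * \<delta> / (2 * (1 + l)) * (1 + l)"
    using l h(1) by (intro close[rule_format] steepD(1)[OF f] hL steep_lipschitz[OF f] h_lip) auto
  also have "l * \<delta> / (2 * (1 + l)) * (1 + l) = l * (\<delta> / 2)" using l by (simp add: field_simps)
  finally have mh: "m h > dnorm z m + l * rate - l * \<delta>"
    using mf by (simp add: algebra_simps)
  let ?u = "\<lambda>p. 1 * decay p + (-1) * far_decay F p"
  have bu: "bounded (?u ` Mt)" by (rule bounded_combination[OF bounded_decay bounded_far_decay])
  have "m h = L (deleeuw h)" by (simp add: L_deleeuw[OF hL])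
  also have "\<dots> \<le> L (\<lambda>p. 1 * 1 + l * ?u p)"
  proof (rule L_mono[OF bounded_deleeuw[OF hL] bounded_combination[OF bounded_one bu]])
    fix p :: "'a \<times> 'a" assume "p \<in> Mt"
    moreover have "\<forall>p\<in>Mt. deleeuw h p \<le> 1 + l * (decay p - far_decay F p)"
      unfolding slope_le_iff using h(2) by simp
    ultimately show "deleeuw h p \<le> 1 * 1 + l * ?u p" by simp
  qed
  also have "\<dots> = 1 * L (\<lambda>_. 1) + l * (1 * L decay + (-1) * L (far_decay F))"
    by (subst L_linear[OF bounded_one bu], subst L_linear[OF bounded_decay bounded_far_decay]) (rule refl)
  also have "\<dots> \<le> dnorm z m + l * (rate - L (far_decay F))"
    using L_one L_decay l by simp
  finally have "l * L (far_decay F) \<le> l * \<delta>" using mh by (simp add: algebra_simps)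
  then show thesis using that[OF F(1) Fne] l by simp
qed

text \<open>Truncation does not alter f on the finite set that almost carries m, so m changes
  little; but an oscillation of at most 2R forces slopes of at most 2R/dist. What these slopes lack
  from 1 is thus small under \<open>L\<close>.\<close>

lemma long_small:
  assumes m: "m \<in> free_space z" and \<delta>: "\<delta> > 0"
  obtains R where "R > 0" "L (\<lambda>p. 1 - min 1 (R / dist (fst p) (snd p))) \<le> \<delta>"
proof -
  have \<delta>2: "\<delta> / 2 > 0" using \<delta> by simp
  obtain f where f: "f \<in> Lip0 z" "\<And>x y. f x - f y \<le> dist x y" "m f > dnorm z m - \<delta> / 2"
    using nearly_norming[OF \<delta>2] by blast
  obtain F where F: "finite F" "z \<in> F"
    and close: "\<forall>f\<in>Lip0 z. \<forall>g\<in>Lip0 z. \<forall>C\<ge>0. (\<forall>x y. f x - f y \<le> C * dist x y) \<longrightarrow>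
       (\<forall>x y. g x - g y \<le> C * dist x y) \<longrightarrow> (\<forall>x\<in>F. f x = g x) \<longrightarrow> m f \<le> m g + \<delta> / 2 * C"
    by (rule free_space_almost_finite[OF m \<delta>2])
  define R where "R = 1 + (\<Sum>x\<in>F. \<bar>f x\<bar>)"
  have R: "R > 0" by (simp add: R_def add_pos_nonneg sum_nonneg)
  have fR: "\<bar>f x\<bar> \<le> R" if "x \<in> F" for x
    using member_le_sum[OF that, of "\<lambda>x. \<bar>f x\<bar>"] F(1) by (simp add: R_def)
  define h where "h x = max (- R) (min R (f x))" for x
  have h_lip: "h x - h y \<le> 1 * dist x y" for x y
    using f(2)[of x y] zero_le_dist[of x y] R unfolding h_def by linarith
  have hf: "h x = f x" if "x \<in> F" for x using fR[OF that] by (simp add: h_def abs_le_iff)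
  have hL: "h \<in> Lip0 z"
    using hf[OF F(2)] Lip0_zero[OF f(1)] h_lip by (intro Lip0I[of _ _ 1]) auto
  have "m f \<le> m h + \<delta> / 2 * 1"
    using f(2) hf h_lip by (intro close[rule_format] f(1) hL) auto
  then have mh: "m h > dnorm z m - \<delta>" using f(3) by simp
  let ?k = "\<lambda>p::'a \<times> 'a. min 1 (2 * R / dist (fst p) (snd p))"
  have bk: "bounded (?k ` Mt)"
    using R by (intro bounded_image_real[of _ _ 1]) (auto simp: abs_le_iff min_le_iff_disj
        intro: order_trans[of _ 0])
  have "m h = L (deleeuw h)" by (simp add: L_deleeuw[OF hL])
  also have "\<dots> \<le> L ?k"
  proof (rule L_mono[OF bounded_deleeuw[OF hL] bk])
    fix p :: "'a \<times> 'a" assume "p \<in> Mt"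
    moreover have "\<forall>p\<in>Mt. deleeuw h p \<le> ?k p"
      unfolding slope_le_iff
    proof (intro allI impI)
      fix x y :: 'a assume "x \<noteq> y"
      moreover have "h x - h y \<le> 2 * R" using R by (simp add: h_def max_def min_def)
      ultimately show "h x - h y \<le> ?k (x, y) * dist x y"
        using h_lip[of x y] by (auto simp: min_def)
    qed
    ultimately show "deleeuw h p \<le> ?k p" by blast
  qed
  finally have "L (\<lambda>p. 1 - ?k p) \<le> \<delta>"
    using mh L_linear[OF bounded_one bk, of 1 "-1"] L_one by simp
  then show thesis using that[of "2 * R"] R by simp
qed

end

section \<open>The measure on the compactification\<close>

lemma ev_Mt_apply: "g \<in> Cb_Mt \<Longrightarrow> ev_Mt p g = g p"
  by (simp add: ev_Mt_def)

lemma ev_Mt_in_beta: "p \<in> Mt \<Longrightarrow> ev_Mt p \<in> beta_Mt"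
  unfolding beta_Mt_def by (rule subsetD[OF closure_subset]) (rule imageI)

lemma continuous_on_coordinate: "continuous_on A (\<lambda>\<zeta>. \<zeta> g :: real)"
  by (rule continuous_on_subset[OF continuous_on_product_coordinates]) simp

text \<open>The filter is the trace on \<open>Mt\<close> of the neighbourhoods of
  \<open>\<zeta>\<close>, nontrivial because \<open>\<zeta>\<close> lies in the closure. Along it
  \<open>\<zeta>\<close> acts as a limit over actual pairs, to which estimates for pairs
  apply.\<close>

lemma beta_Mt_filter:
  assumes "\<zeta> \<in> beta_Mt"
  obtains \<F> where "\<F> \<noteq> bot" "eventually (\<lambda>p. p \<in> Mt) \<F>"
    "\<forall>g\<in>Cb_Mt. (g \<longlongrightarrow> \<zeta> g) \<F>"
proof -
  let ?F = "inf (filtercomap ev_Mt (nhds \<zeta>)) (principal Mt)"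
  have "?F \<noteq> bot"
  proof
    assume "?F = bot"
    then have "eventually (\<lambda>p. p \<notin> Mt) (filtercomap ev_Mt (nhds \<zeta>))"
      by (simp add: trivial_limit_def eventually_inf_principal)
    then obtain Q where "eventually Q (nhds \<zeta>)" and Q: "\<And>p. Q (ev_Mt p) \<Longrightarrow> p \<notin> Mt"
      unfolding eventually_filtercomap by blast
    then obtain U where U: "open U" "\<zeta> \<in> U" "\<And>x. x \<in> U \<Longrightarrow> Q x"
      unfolding eventually_nhds by blast
    have "U \<inter> ev_Mt ` Mt = {}" using U(3) Q by blast
    then have "U \<inter> beta_Mt = {}" unfolding beta_Mt_def by (simp add: open_Int_closure_eq_empty[OF U(1)])
    then show False using U(2) assms by blast
  qed
  moreover have "eventually (\<lambda>p. p \<in> Mt) ?F" by (simp add: eventually_inf_principal)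
  moreover have "\<forall>g\<in>Cb_Mt. (g \<longlongrightarrow> \<zeta> g) ?F"
  proof
    fix g :: "'a \<times> 'a \<Rightarrow> real" assume g: "g \<in> Cb_Mt" 
    have "filterlim ev_Mt (nhds \<zeta>) ?F"
      by (rule filterlim_mono[OF filterlim_filtercomap order_refl inf_le1])
    then have "((\<lambda>p. ev_Mt p g) \<longlongrightarrow> \<zeta> g) ?F"
      by (rule continuous_on_tendsto_compose[OF continuous_on_coordinate[of UNIV]]) simp_all
    then show "(g \<longlongrightarrow> \<zeta> g) ?F" by (simp add: ev_Mt_apply[OF g])
  qed
  ultimately show thesis by (rule that)
qed

lemma beta_Mt_nonneg:
  assumes "\<zeta> \<in> beta_Mt" "g \<in> Cb_Mt" "\<And>p. p \<in> Mt \<Longrightarrow> 0 \<le> g p"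
  shows "0 \<le> \<zeta> g"
proof -
  obtain \<F> where F: "\<F> \<noteq> bot" "eventually (\<lambda>p. p \<in> Mt) \<F>" "(g \<longlongrightarrow> \<zeta> g) \<F>"
    using beta_Mt_filter[OF assms(1)] assms(2) by metis
  show ?thesis
    using F(2) assms(3) by (intro tendsto_lowerbound[OF F(3) _ F(1)]) (auto elim: eventually_mono)
qed

lemma euclidean_functions:
  "product_topology (\<lambda>_. euclidean) UNIV = (euclidean :: ('b \<Rightarrow> real) topology)"
  by (simp add: euclidean_product_topology)

lemma Hausdorff_beta_Mt: "Hausdorff_space (top_of_set beta_Mt)"
proof -
  have "Hausdorff_space (euclidean :: (('a \<times> 'a \<Rightarrow> real) \<Rightarrow> real) topology)"
    unfolding euclidean_functions[symmetric] by (simp add: Hausdorff_space_product_topology)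
  then show ?thesis by (rule Hausdorff_space_subtopology)
qed

text \<open>Tychonoff's theorem for a product of intervals, one for each function g. Outside
  \<open>Cb_Mt\<close> the default value 0 of \<open>ev_Mt\<close> keeps the coordinate
  bounded.\<close>

lemma compact_beta_Mt: "compact (beta_Mt :: (('a::metric_space \<times> 'a \<Rightarrow> real) \<Rightarrow> real) set)"
proof -
  have "\<exists>B. \<forall>p\<in>Mt. \<bar>ev_Mt p g\<bar> \<le> B" for g :: "'a \<times> 'a \<Rightarrow> real"
  proof (cases "g \<in> Cb_Mt")
    case True
    then show ?thesis by (auto simp: ev_Mt_def Cb_Mt_def bounded_iff)
  next
    case False
    then show ?thesis by (intro exI[of _ 0]) (simp add: ev_Mt_def)
  qed
  then obtain B where B: "\<And>g (p :: 'a \<times> 'a). p \<in> Mt \<Longrightarrow> \<bar>ev_Mt p g\<bar> \<le> B g" by metis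
  let ?P = "PiE UNIV (\<lambda>g. {- B g .. B g})"
  have "compactin (product_topology (\<lambda>_. euclidean) UNIV) ?P"
    unfolding compactin_PiE by simp
  then have P: "compact ?P" by (simp add: euclidean_product_topology)
  have "closedin (product_topology (\<lambda>_. euclidean) UNIV) ?P"
    unfolding closedin_product_topology by simp
  then have "closed ?P" by (simp add: euclidean_product_topology)
  moreover have "ev_Mt ` Mt \<subseteq> ?P" using B by (auto simp: abs_le_iff minus_le_iff)
  ultimately have "beta_Mt \<subseteq> ?P" unfolding beta_Mt_def by (rule closure_minimal[rotated])
  then have "compact (?P \<inter> beta_Mt)" using P by (intro compact_Int_closed) (auto simp: beta_Mt_def)
  then show ?thesis using \<open>beta_Mt \<subseteq> ?P\<close> by (simp add: Int_absorb1)
qed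

lemma deleeuw_in_Cb:
  assumes "f \<in> Lip0 z"
  shows "deleeuw f \<in> Cb_Mt"
proof -
  obtain C where "lipschitz_on C UNIV f" using assms by (auto simp: Lip0_def)
  then have "continuous_on UNIV f" by (rule lipschitz_on_continuous_on)
  then have c: "continuous_on A f" for A by (rule continuous_on_subset) simp
  have "continuous_on Mt (\<lambda>p. (f (fst p) - f (snd p)) / dist (fst p) (snd p))"
    by (intro continuous_intros continuous_on_compose2[OF c]) (auto simp: Mt_def)
  then show ?thesis using bounded_deleeuw[OF assms] by (simp add: Cb_Mt_def deleeuw_def split_beta)
qed

lemma far_continuous: "continuous_on A (far F)"
  unfolding far_def using infdist_nonneg[of _ F]
  by (intro continuous_intros) (auto simp: add_nonneg_eq_0_iff)

lemma decay_continuous: "continuous_on A decay"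
  unfolding decay_def by (intro continuous_intros) (auto simp: add_nonneg_eq_0_iff)

lemma far_decay_in_Cb: "far_decay F \<in> Cb_Mt"
  unfolding Cb_Mt_def using bounded_far_decay unfolding far_decay_def
  by (auto intro!: continuous_intros decay_continuous continuous_on_compose2[OF far_continuous[of UNIV]])

lemma long_in_Cb:
  assumes "R > 0"
  shows "(\<lambda>p. 1 - min 1 (R / dist (fst p) (snd p))) \<in> Cb_Mt"
  unfolding Cb_Mt_def
proof (intro CollectI conjI)
  show "continuous_on Mt (\<lambda>p::'a \<times> 'a. 1 - min 1 (R / dist (fst p) (snd p)))"
    by (intro continuous_intros) (auto simp: Mt_def)
  show "bounded ((\<lambda>p::'a \<times> 'a. 1 - min 1 (R / dist (fst p) (snd p))) ` Mt)"
  proof (rule bounded_image_real[of _ _ 1])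
    fix p :: "'a \<times> 'a"
    have "0 \<le> R / dist (fst p) (snd p)" using assms by simp
    then show "\<bar>1 - min 1 (R / dist (fst p) (snd p))\<bar> \<le> 1" by (simp add: min_def)
  qed
qed

lemma coordinate_in_Cb:
  assumes "h \<in> BUC" "pr = fst \<or> pr = snd"
  shows "(\<lambda>p. h (pr p)) \<in> Cb_Mt"
proof -
  have "continuous_on UNIV h" "bounded (range h)"
    using assms(1) by (auto simp: BUC_def uniformly_continuous_imp_continuous)
  moreover have "continuous_on Mt pr" using assms(2) by (auto intro: continuous_intros)
  ultimately have "continuous_on Mt (\<lambda>p. h (pr p))"
    by (auto intro: continuous_on_compose2)
  moreover have "bounded ((\<lambda>p. h (pr p)) ` Mt)"
    by (rule bounded_subset[OF \<open>bounded (range h)\<close>]) auto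
  ultimately show ?thesis by (simp add: Cb_Mt_def)
qed

text \<open>Total boundedness along the filter makes its image under a coordinate a Cauchy filter, because
  each \<open>min 1 (dist \<cdot> x)\<close> has a limit along it.\<close>

lemma coordinate_converges:
  fixes \<zeta> :: "('a::metric_space \<times> 'a \<Rightarrow> real) \<Rightarrow> real"
  assumes complete: "complete (UNIV :: 'a set)" and pr: "pr = fst \<or> pr = snd"
    and F: "\<F> \<noteq> bot" and lim: "\<forall>g\<in>Cb_Mt. (g \<longlongrightarrow> \<zeta> g) \<F>"
    and near: "\<And>e. e > 0 \<Longrightarrow> \<exists>F. finite F \<and> F \<noteq> {} \<and> eventually (\<lambda>p. infdist (pr p) F < e) \<F>"
  obtains x where "\<forall>h\<in>BUC. \<zeta> (\<lambda>p. h (pr p)) = h x"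
proof -
  have ball: "\<exists>x. eventually (\<lambda>p. dist (pr p) x < e) \<F>" if e: "e > 0" for e
  proof -
    \<comment> \<open>Being below 1 makes the truncation in \<open>?h\<close> inactive: a value of
      \<open>?h x\<close> below \<open>min 1 e\<close> bounds the distance itself.\<close>
    define e' where "e' = min 1 e / 2"
    have e': "0 < e'" "e' < 1" "e' < e" using e by (auto simp: e'_def min_def)
    obtain F where Ff: "finite F" "F \<noteq> {}" and ev: "eventually (\<lambda>p. infdist (pr p) F < e') \<F>"
      using near[OF e'(1)] by blast
    let ?h = "\<lambda>x y::'a. min 1 (dist y x)"
    have hB: "?h x \<in> BUC" for x
    proof -
      have "uniformly_continuous_on UNIV (?h x)"
        unfolding uniformly_continuous_on_def
      proof (intro allI impI)
        fix e :: real assume "e > 0"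
        moreover have "dist (?h x a) (?h x b) \<le> dist a b" for a b
          using dist_triangle[of a x b] dist_triangle[of b x a] unfolding dist_real_def
          by (simp add: dist_commute)
        ultimately show "\<exists>d>0. \<forall>a\<in>UNIV. \<forall>b\<in>UNIV. dist b a < d \<longrightarrow> dist (?h x b) (?h x a) < e"
          by (metis le_less_trans)
      qed
      then show ?thesis
        by (auto simp: BUC_def intro!: bounded_image_real[of _ _ 1])
    qed
    let ?l = "\<lambda>x. \<zeta> (\<lambda>p. ?h x (pr p))"
    have l: "((\<lambda>p. ?h x (pr p)) \<longlongrightarrow> ?l x) \<F>" for x
      using lim coordinate_in_Cb[OF hB pr] by blast
    have "\<exists>x\<in>F. ?l x \<le> e'"
    proof (rule ccontr)
      assume "\<not> (\<exists>x\<in>F. ?l x \<le> e')"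
      then have "eventually (\<lambda>p. e' < ?h x (pr p)) \<F>" if "x \<in> F" for x
        using order_tendstoD(1)[OF l] that by force
      then have "eventually (\<lambda>p. \<forall>x\<in>F. e' < ?h x (pr p)) \<F>"
        using Ff(1) by (simp add: eventually_ball_finite_distrib)
      with ev have "eventually (\<lambda>p. False) \<F>"
      proof eventually_elim
        case (elim p)
        have "infdist (pr p) F = Min (dist (pr p) ` F)"
          using Ff by (simp add: infdist_notempty cInf_eq_Min)
        moreover have "Min (dist (pr p) ` F) \<in> dist (pr p) ` F" using Ff by (intro Min_in) auto
        ultimately obtain x where x: "x \<in> F" "infdist (pr p) F = dist (pr p) x" by auto
        then show ?case using elim by force
      qed
      then show False using F by (simp add: trivial_limit_def)
    qed
    then obtain x where "?l x \<le> e'" by blast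
    then have "?l x < min 1 e" using e' by simp
    then have "eventually (\<lambda>p. ?h x (pr p) < min 1 e) \<F>" by (rule order_tendstoD(2)[OF l])
    then have "eventually (\<lambda>p. dist (pr p) x < e) \<F>" by (rule eventually_mono) auto
    then show ?thesis by blast
  qed
  let ?G = "filtermap pr \<F>"
  have "cauchy_filter ?G"
    unfolding cauchy_filter_metric
  proof (intro allI impI)
    fix e :: real assume "e > 0"
    then obtain x where "eventually (\<lambda>p. dist (pr p) x < e / 2) \<F>" using ball[of "e / 2"] by auto
    then have "eventually (\<lambda>y. dist y x < e / 2) ?G" by (simp add: eventually_filtermap)
    moreover have "dist a b < e" if "dist a x < e / 2" "dist b x < e / 2" for a b
      using that by (rule dist_triangle_half_l)
    ultimately show "\<exists>P. eventually P ?G \<and> (\<forall>x y. P x \<and> P y \<longrightarrow> dist x y < e)"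
      by (intro exI[of _ "\<lambda>y. dist y x < e / 2"]) blast
  qed
  moreover have "?G \<noteq> bot" using F by (simp add: filtermap_bot_iff)
  ultimately obtain x where "?G \<le> nhds x"
    using complete unfolding complete_uniform by auto
  then have x: "filterlim pr (nhds x) \<F>" by (simp add: filterlim_def)
  show thesis
  proof (rule that[of x], rule ballI)
    fix h :: "'a \<Rightarrow> real" assume h: "h \<in> BUC"
    then have "isCont h x"
      by (auto simp: BUC_def continuous_on_eq_continuous_at dest: uniformly_continuous_imp_continuous)
    then have "((\<lambda>p. h (pr p)) \<longlongrightarrow> h x) \<F>" using x by (rule isCont_tendsto_compose)
    then show "\<zeta> (\<lambda>p. h (pr p)) = h x"
      using lim[rule_format, OF coordinate_in_Cb[OF h pr]] tendsto_unique[OF F] by blast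
  qed
qed

text \<open>The condition on long pairs bounds the distances along the filter of
  \<open>\<zeta>\<close> by some D, so \<open>decay\<close> is at least 1/(1 + D) there. Small
  \<open>far_decay\<close> then puts both coordinates near a finite set, as
  \<open>coordinate_converges\<close> asks.\<close>

lemma p_inv_MM_I:
  fixes \<zeta> :: "('a::metric_space \<times> 'a \<Rightarrow> real) \<Rightarrow> real"
  assumes complete: "complete (UNIV :: 'a set)" and \<zeta>: "\<zeta> \<in> beta_Mt"
    and long: "R > 0" "\<zeta> (\<lambda>p. 1 - min 1 (R / dist (fst p) (snd p))) < 1"
    and far: "\<And>e. e > 0 \<Longrightarrow> \<exists>F. finite F \<and> F \<noteq> {} \<and> \<zeta> (far_decay F) < e"
  shows "\<zeta> \<in> p_inv_MM"
proof -
  obtain \<F> where F: "\<F> \<noteq> bot" "eventually (\<lambda>p. p \<in> Mt) \<F>"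
    and lim: "\<forall>g\<in>Cb_Mt. (g \<longlongrightarrow> \<zeta> g) \<F>"
    by (rule beta_Mt_filter[OF \<zeta>])
  obtain c where c: "\<zeta> (\<lambda>p. 1 - min 1 (R / dist (fst p) (snd p))) < c" "0 < c" "c < 1"
    using dense[of "max 0 (\<zeta> (\<lambda>p. 1 - min 1 (R / dist (fst p) (snd p))))" 1] long(2) by auto
  define D where "D = R / (1 - c)"
  have D: "D > 0" using c long by (simp add: D_def)
  have "eventually (\<lambda>p. 1 - min 1 (R / dist (fst p) (snd p)) < c) \<F>"
    by (rule order_tendstoD(2)[OF lim[rule_format, OF long_in_Cb[OF long(1)]] c(1)])
  with F(2) have ev_D: "eventually (\<lambda>p. dist (fst p) (snd p) \<le> D) \<F>"
  proof eventually_elim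
    case (elim p)
    then have "dist (fst p) (snd p) > 0" by (auto simp: Mt_def)
    moreover have "1 - c < R / dist (fst p) (snd p)" using elim(2) by linarith
    ultimately show ?case using c by (simp add: D_def field_simps)
  qed
  have near: "\<exists>F. finite F \<and> F \<noteq> {} \<and> eventually (\<lambda>p. infdist (pr p) F < e) \<F>"
    if e: "e > 0" and pr: "pr = fst \<or> pr = snd" for e pr
  proof -
    \<comment> \<open>e / (1 + e) is the value of \<open>far\<close> at distance e from
      \<open>F\<close>. The divisor combines the lower bound 1/(1 + D) for \<open>decay\<close> with
      the 1/2 from the mean in \<open>far_decay\<close>.\<close>
    define \<eta> where "\<eta> = e / (1 + e) / (2 * (1 + D))"
    have \<eta>: "\<eta> > 0" using e D by (simp add: \<eta>_def)
    obtain F where Ff: "finite F" "F \<noteq> {}" "\<zeta> (far_decay F) < \<eta>" using far[OF \<eta>] by blast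
    have "eventually (\<lambda>p. far_decay F p < \<eta>) \<F>"
      by (rule order_tendstoD(2)[OF lim[rule_format, OF far_decay_in_Cb] Ff(3)])
    with ev_D have "eventually (\<lambda>p. infdist (pr p) F < e) \<F>"
    proof eventually_elim
      case (elim p)
      have i: "0 \<le> infdist (pr p) F" by (rule infdist_nonneg)
      have dec: "1 / (1 + D) \<le> decay p"
        unfolding decay_def using elim(1) D by (intro divide_left_mono) (auto intro!: mult_pos_pos add_pos_nonneg)
      have "far F (pr p) / 2 \<le> (far F (fst p) + far F (snd p)) / 2"
        using pr far_nonneg[of F "fst p"] far_nonneg[of F "snd p"] by auto
      then have "1 / (1 + D) * (far F (pr p) / 2) \<le> far_decay F p"
        unfolding far_decay_def using dec D far_nonneg[of F "pr p"] by (intro mult_mono decay_nonneg) auto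
      also have "\<dots> < \<eta>" by (rule elim(2))
      finally have "far F (pr p) / (2 * (1 + D)) < e / (1 + e) / (2 * (1 + D))"
        by (simp add: \<eta>_def mult.commute)
      then have "far F (pr p) < e / (1 + e)"
        using D by (subst (asm) divide_less_cancel) simp
      then have "1 / (1 + e) < 1 / (1 + infdist (pr p) F)"
        using e by (simp add: far_def field_simps)
      then show ?case using e i by (simp add: field_simps)
    qed
    then show ?thesis using Ff by blast
  qed
  obtain x where x: "\<forall>h\<in>BUC. \<zeta> (\<lambda>p. h (fst p)) = h x"
    using coordinate_converges[OF complete _ F(1) lim near, of fst] by blast
  obtain y where y: "\<forall>h\<in>BUC. \<zeta> (\<lambda>p. h (snd p)) = h y"
    using coordinate_converges[OF complete _ F(1) lim near, of snd] by blast
  have "p1 \<zeta> = ev_M x" "p2 \<zeta> = ev_M y"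
    using x y by (simp_all add: p1_def p2_def ev_M_def case_prod_unfold fun_eq_iff)
  then show ?thesis using \<zeta> by (simp add: p_inv_MM_def)
qed

section \<open>Transfer of the functional to a measure on the compactification\<close>

context optimal_functional
begin

definition beta_functional :: "((('a \<times> 'a \<Rightarrow> real) \<Rightarrow> real) \<Rightarrow> real) \<Rightarrow> real" where
  "beta_functional \<Phi> = L (\<lambda>p. \<Phi> (ev_Mt p))"

lemma bounded_continuous_on_beta:
  assumes "continuous_on beta_Mt \<Phi>"
  shows "bounded ((\<lambda>p. \<Phi> (ev_Mt p) :: real) ` Mt)"
proof -
  have "bounded (\<Phi> ` beta_Mt)"
    using compact_continuous_image[OF assms compact_beta_Mt] by (rule compact_imp_bounded)
  then show ?thesis by (rule bounded_subset) (auto intro: ev_Mt_in_beta)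
qed

sublocale beta: positive_functional beta_Mt beta_functional
proof
  show "compact (beta_Mt :: (('a \<times> 'a \<Rightarrow> real) \<Rightarrow> real) set)" by (rule compact_beta_Mt)
  show "Hausdorff_space (top_of_set (beta_Mt :: (('a \<times> 'a \<Rightarrow> real) \<Rightarrow> real) set))"
    by (rule Hausdorff_beta_Mt)
next
  fix f g :: "(('a \<times> 'a \<Rightarrow> real) \<Rightarrow> real) \<Rightarrow> real" and a b
  assume "continuous_on beta_Mt f" "continuous_on beta_Mt g"
  then show "beta_functional (\<lambda>x. a * f x + b * g x) = a * beta_functional f + b * beta_functional g"
    unfolding beta_functional_def by (intro L_linear bounded_continuous_on_beta)
next
  fix f :: "(('a \<times> 'a \<Rightarrow> real) \<Rightarrow> real) \<Rightarrow> real"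
  assume "continuous_on beta_Mt f" "\<And>x. x \<in> beta_Mt \<Longrightarrow> 0 \<le> f x"
  then show "0 \<le> beta_functional f"
    unfolding beta_functional_def by (intro L_nonneg bounded_continuous_on_beta) (auto intro: ev_Mt_in_beta)
qed

abbreviation "\<mu> \<equiv> beta.riesz_measure"

lemma integral_mu:
  assumes "g \<in> Cb_Mt"
  shows "(\<integral>\<zeta>. \<zeta> g \<partial>\<mu>) = L g"
proof -
  have "(\<integral>\<zeta>. \<zeta> g \<partial>\<mu>) = beta_functional (\<lambda>\<zeta>. \<zeta> g)"
    by (rule beta.integral_riesz_measure[OF continuous_on_coordinate])
  then show ?thesis by (simp add: beta_functional_def ev_Mt_apply[OF assms])
qed

text \<open>The infimum of countably many members of \<open>H\<close> with \<open>L\<close>-values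
  tending to 0 has integral 0, so it vanishes almost everywhere. Countability keeps the infimum
  measurable.\<close>

lemma AE_mu_small:
  assumes H: "\<And>g. g \<in> H \<Longrightarrow> g \<in> Cb_Mt" "\<And>g p. g \<in> H \<Longrightarrow> p \<in> Mt \<Longrightarrow> 0 \<le> g p"
    and small: "\<And>\<delta>. \<delta> > 0 \<Longrightarrow> \<exists>g\<in>H. L g \<le> \<delta>"
  shows "AE \<zeta> in \<mu>. \<forall>e>0. \<exists>g\<in>H. \<zeta> g < e"
proof -
  have "\<exists>g\<in>H. L g \<le> 1 / Suc j" for j by (rule small) simp
  then obtain g where g: "\<And>j. g j \<in> H" "\<And>j. L (g j) \<le> 1 / Suc j" by metis
  let ?u = "\<lambda>\<zeta>. INF j. ennreal (\<zeta> (g j))"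
  have meas: "(\<lambda>\<zeta>. \<zeta> (g j)) \<in> borel_measurable \<mu>" for j
    by (rule beta.measurable_riesz_measure[OF continuous_on_coordinate])
  have "(\<integral>\<^sup>+\<zeta>. ?u \<zeta> \<partial>\<mu>) \<le> ennreal (1 / Suc j)" for j
  proof -
    have "(\<integral>\<^sup>+\<zeta>. ?u \<zeta> \<partial>\<mu>) \<le> (\<integral>\<^sup>+\<zeta>. ennreal (\<zeta> (g j)) \<partial>\<mu>)"
      by (intro nn_integral_mono INF_lower) simp
    also have "\<dots> = ennreal (\<integral>\<zeta>. \<zeta> (g j) \<partial>\<mu>)"
    proof (rule nn_integral_eq_integral)
      show "integrable \<mu> (\<lambda>\<zeta>. \<zeta> (g j))"
        by (rule beta.integrable_riesz_measure[OF continuous_on_coordinate])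
      show "AE \<zeta> in \<mu>. 0 \<le> \<zeta> (g j)"
        using H g(1) by (intro AE_I2) (auto simp: beta.space_riesz_measure intro: beta_Mt_nonneg)
    qed
    also have "\<dots> = ennreal (L (g j))" using integral_mu[OF H(1)[OF g(1)]] by simp
    finally show ?thesis using g(2)[of j] by (meson ennreal_leI order_trans)
  qed
  then have "(\<integral>\<^sup>+\<zeta>. ?u \<zeta> \<partial>\<mu>) \<le> 0"
  proof (intro LIMSEQ_le_const)
    show "(\<lambda>j. ennreal (1 / Suc j)) \<longlonglongrightarrow> 0"
      using tendsto_ennrealI[OF LIMSEQ_inverse_real_of_nat] by (simp add: inverse_eq_divide)
  qed blast
  then have "AE \<zeta> in \<mu>. ?u \<zeta> = 0"
    using meas by (subst (asm) le_zero_eq, subst (asm) nn_integral_0_iff_AE) auto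
  then show ?thesis
  proof eventually_elim
    case (elim \<zeta>)
    show ?case
    proof (intro allI impI)
      fix e :: real assume e: "e > 0"
      then have "?u \<zeta> < ennreal e" using elim by simp
      then obtain j where "ennreal (\<zeta> (g j)) < ennreal e" unfolding INF_less_iff by blast
      then have "\<zeta> (g j) < e" by (metis ennreal_leI not_le)
      then show "\<exists>g\<in>H. \<zeta> g < e" using g(1) by blast
    qed
  qed
qed

lemma AE_mu_p_inv_MM:
  assumes complete: "complete (UNIV :: 'a set)" and m: "m \<in> free_space z"
  shows "AE \<zeta> in \<mu>. \<zeta> \<in> p_inv_MM"
proof -
  let ?long = "\<lambda>R (p :: 'a \<times> 'a). 1 - min 1 (R / dist (fst p) (snd p))"
  have "AE \<zeta> in \<mu>. \<forall>e>0. \<exists>g\<in>{?long R |R. R > 0}. \<zeta> g < e"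
  proof (rule AE_mu_small)
    fix \<delta> :: real assume "\<delta> > 0"
    then obtain R where "R > 0" "L (?long R) \<le> \<delta>" by (rule long_small[OF m])
    then show "\<exists>g\<in>{?long R |R. R > 0}. L g \<le> \<delta>" by blast
  qed (auto intro: long_in_Cb)
  moreover have "AE \<zeta> in \<mu>. \<forall>e>0. \<exists>g\<in>{far_decay F |F. finite F \<and> F \<noteq> {}}. \<zeta> g < e"
  proof (rule AE_mu_small)
    fix \<delta> :: real assume "\<delta> > 0"
    then obtain F where "finite F" "F \<noteq> {}" "L (far_decay F) \<le> \<delta>" by (rule far_decay_small[OF m])
    then show "\<exists>g\<in>{far_decay F |F. finite F \<and> F \<noteq> {}}. L g \<le> \<delta>" by blast
  qed (auto intro: far_decay_in_Cb far_decay_nonneg)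
  moreover have "AE \<zeta> in \<mu>. \<zeta> \<in> beta_Mt"
    by (rule AE_I2) (simp add: beta.space_riesz_measure)
  ultimately show ?thesis
  proof eventually_elim
    case (elim \<zeta>)
    \<comment> \<open>\<open>R\<close> may depend on \<open>\<zeta>\<close>; a value below 1 is
      enough to bound the distances along its filter.\<close>
    obtain R where R: "R > 0" "\<zeta> (?long R) < 1"
      using elim(1)[rule_format, of 1] by auto
    show ?case
      by (rule p_inv_MM_I[OF complete elim(3) R]) (use elim(2) in blast)
  qed
qed

end

theorem theorem5p1:
  fixes z :: "'a::metric_space" and m :: "('a \<Rightarrow> real) \<Rightarrow> real"
  assumes "complete (UNIV :: 'a set)"
    and "\<exists>a b c :: 'a. a \<noteq> b \<and> a \<noteq> c \<and> b \<noteq> c"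
    and "m \<in> free_space z"
  shows "\<exists>\<mu>. radon_on (beta_Mt :: ((('a \<times> 'a) \<Rightarrow> real) \<Rightarrow> real) set) \<mu>
           \<and> measure \<mu> (space \<mu>) = dnorm z (deleeuw_adj \<mu>)
           \<and> (\<forall>f\<in>Lip0 z. deleeuw_adj \<mu> f = m f)
           \<and> (\<exists>N\<in>sets \<mu>. beta_Mt - p_inv_MM \<subseteq> N \<and> emeasure \<mu> N = 0)"
proof -
  interpret lip_functional z m
  proof
    show "\<exists>a b :: 'a. a \<noteq> b" using assms(2) by blast
    show "lip0_dual z m" using assms(3) by (simp add: free_space_def)
  qed
  obtain L where "optimal_functional z m L" by (rule optimal_functional_exists)
  then interpret optimal_functional z m L .
  have repr: "deleeuw_adj \<mu> f = m f" if "f \<in> Lip0 z" for f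
    unfolding deleeuw_adj_def using integral_mu[OF deleeuw_in_Cb[OF that]] L_deleeuw[OF that] by simp
  have "measure \<mu> (space \<mu>) = dnorm z m"
    by (simp add: beta.space_riesz_measure beta.measure_riesz_measure beta_functional_def L_one)
  \<comment> \<open>\<open>dnorm\<close> reads a functional only on \<open>Lip0 z\<close>, where the
    two agree.\<close>
  also have "\<dots> = dnorm z (deleeuw_adj \<mu>)"
    unfolding dnorm_def by (rule SUP_cong) (simp_all add: repr)
  finally have norm: "measure \<mu> (space \<mu>) = dnorm z (deleeuw_adj \<mu>)" .
  obtain N where "{\<zeta> \<in> space \<mu>. \<zeta> \<notin> p_inv_MM} \<subseteq> N" "emeasure \<mu> N = 0" "N \<in> sets \<mu>"
    using AE_mu_p_inv_MM[OF assms(1,3)] by (rule AE_E)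
  then have "\<exists>N\<in>sets \<mu>. beta_Mt - p_inv_MM \<subseteq> N \<and> emeasure \<mu> N = 0"
    unfolding beta.space_riesz_measure by (intro bexI[of _ N]) auto
  then show ?thesis
    using beta.radon_riesz_measure norm repr by blast
qed

end
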